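(* Let $n\geqslant 2$ be an integer, let $q$ be a prime power, and let $k$ be an integer with $1<k\leqslant n$. Then $\mathrm{P\Gamma U}(2n+1,q)$, acting on the set of $k$-dimensional totally isotropic subspaces, is non-spreading.
   Context: $\mathrm{P\Gamma U}(2n+1,q)$ is the collineation group (projective semisimilarity group) of the Hermitian polar space $\mathsf{H}(2n,q^2)$, defined by a non-degenerate Hermitian form on $\mathbb{F}_{q^2}^{2n+1}$. Dimensions are vector space dimensions; the maximal totally isotropic subspaces have dimension $n$. Multisets on $\Omega$ are functions $\Omega\to\mathbb{Z}_{\ge 0}$ (multiplicities), sets are identified with characteristic functions, $|X|$ is the sum of multiplicities, and $(X\star Y)(i)=X(i)Y(i)$. A multiset (or set) is trivial if it is constant or only one element has nonzero multiplicity. A transitive permutation group $G$ on a finite set $\Omega$ is non-spreading if there exist a nontrivial multiset $X$ and a nontrivial set $Y$ on $\Omega$ such that $|X|$ divides $|\Omega|$ and $|X\star Y^g|$ is constant for all $g\in G$. *)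

theory Defs
  imports
    "HOL-Analysis.Cartesian_Space"
    "HOL-Algebra.Group_Action"
    "HOL-Number_Theory.Prime_Powers"
    "HOL-Library.Indicator_Function"
begin

section \<open>Non-spreading group actions\<close>

text \<open>
  A multiset on \<open>\<Omega>\<close> is a multiplicity function \<open>'b \<Rightarrow> nat\<close>; values outside \<open>\<Omega>\<close> are
  irrelevant to every notion below. A set \<open>Y \<subseteq> \<Omega>\<close> is identified with \<open>indicator Y\<close>.
\<close>

definition msize :: "'b set \<Rightarrow> ('b \<Rightarrow> nat) \<Rightarrow> nat" where
  "msize \<Omega> X = (\<Sum>i\<in>\<Omega>. X i)"

definition mstar :: "('b \<Rightarrow> nat) \<Rightarrow> ('b \<Rightarrow> nat) \<Rightarrow> 'b \<Rightarrow> nat" where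
  "mstar X Y = (\<lambda>i. X i * Y i)"

definition trivial_multiset :: "'b set \<Rightarrow> ('b \<Rightarrow> nat) \<Rightarrow> bool" where
  "trivial_multiset \<Omega> X \<longleftrightarrow>
     (\<exists>c. \<forall>i\<in>\<Omega>. X i = c) \<or> (\<exists>!i. i \<in> \<Omega> \<and> X i \<noteq> 0)"

text \<open>
  The permutation group is given as an action of \<open>G\<close> on \<open>\<Omega>\<close>, i.e. a homomorphism
  \<open>\<phi>\<close> into the symmetric group on \<open>\<Omega>\<close>; only the image of \<open>\<phi>\<close> matters.
\<close>

definition non_spreading ::
    "('g, 'm) monoid_scheme \<Rightarrow> 'b set \<Rightarrow> ('g \<Rightarrow> 'b \<Rightarrow> 'b) \<Rightarrow> bool" where
  "non_spreading G \<Omega> \<phi> \<longleftrightarrow>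
     finite \<Omega> \<and> transitive_action G \<Omega> \<phi> \<and>
     (\<exists>X Y. \<not> trivial_multiset \<Omega> X \<and>
            Y \<subseteq> \<Omega> \<and> \<not> trivial_multiset \<Omega> (indicator Y) \<and>
            msize \<Omega> X dvd card \<Omega> \<and>
            (\<exists>c. \<forall>g\<in>carrier G. msize \<Omega> (mstar X (indicator (\<phi> g ` Y))) = c))"

section \<open>Hermitian forms and their semisimilarities\<close>

text \<open>
  Over a field with \<open>q\<^sup>2\<close> elements the involutory automorphism is \<open>x \<mapsto> x ^ q\<close>.
  Linearity is in the first argument; conjugate-linearity in the second follows.
\<close>

definition hermitian_form :: "nat \<Rightarrow> ('a::field ^ 'd \<Rightarrow> 'a ^ 'd \<Rightarrow> 'a) \<Rightarrow> bool" where
  "hermitian_form q B \<longleftrightarrow>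
     (\<forall>u v w. B (u + v) w = B u w + B v w) \<and>
     (\<forall>c u v. B (c *s u) v = c * B u v) \<and>
     (\<forall>u v. B v u = B u v ^ q)"

definition nondegenerate :: "('a::field ^ 'd \<Rightarrow> 'a ^ 'd \<Rightarrow> 'a) \<Rightarrow> bool" where
  "nondegenerate B \<longleftrightarrow> (\<forall>u. (\<forall>v. B u v = 0) \<longrightarrow> u = 0)"

definition totally_isotropic ::
    "('a::field ^ 'd \<Rightarrow> 'a ^ 'd \<Rightarrow> 'a) \<Rightarrow> nat \<Rightarrow> ('a ^ 'd) set set" where
  "totally_isotropic B k =
     {U. vec.subspace U \<and> vec.dim U = k \<and> (\<forall>u\<in>U. \<forall>v\<in>U. B u v = 0)}"

definition field_automorphism :: "('a::field \<Rightarrow> 'a) \<Rightarrow> bool" where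
  "field_automorphism \<sigma> \<longleftrightarrow>
     bij \<sigma> \<and> (\<forall>x y. \<sigma> (x + y) = \<sigma> x + \<sigma> y) \<and> (\<forall>x y. \<sigma> (x * y) = \<sigma> x * \<sigma> y)"

definition semisimilarity ::
    "('a::field ^ 'd \<Rightarrow> 'a ^ 'd \<Rightarrow> 'a) \<Rightarrow> ('a ^ 'd \<Rightarrow> 'a ^ 'd) \<Rightarrow> bool" where
  "semisimilarity B f \<longleftrightarrow>
     bij f \<and> (\<forall>u v. f (u + v) = f u + f v) \<and>
     (\<exists>\<sigma> c. field_automorphism \<sigma> \<and> c \<noteq> 0 \<and>
        (\<forall>a v. f (a *s v) = \<sigma> a *s f v) \<and>
        (\<forall>u v. B (f u) (f v) = c * \<sigma> (B u v)))"

definition GammaU ::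
    "('a::field ^ 'd \<Rightarrow> 'a ^ 'd \<Rightarrow> 'a) \<Rightarrow> ('a ^ 'd \<Rightarrow> 'a ^ 'd) monoid" where
  "GammaU B = (BijGroup UNIV)\<lparr>carrier := {f. semisimilarity B f}\<rparr>"

definition scalar_maps :: "('a::field ^ 'd \<Rightarrow> 'a ^ 'd) set" where
  "scalar_maps = {(\<lambda>v. a *s v) | a. a \<noteq> 0}"

definition PGammaU ::
    "('a::field ^ 'd \<Rightarrow> 'a ^ 'd \<Rightarrow> 'a) \<Rightarrow> ('a ^ 'd \<Rightarrow> 'a ^ 'd) set monoid" where
  "PGammaU B = GammaU B Mod scalar_maps"

text \<open>
  An element \<open>S\<close> of \<open>PGammaU B\<close> is a coset of the scalars, all of whose members map a
  subspace \<open>U\<close> to the same subspace; \<open>the_elem\<close> picks out that common image. The result is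
  made extensional on \<open>totally_isotropic B k\<close>, as \<open>BijGroup\<close> requires.
\<close>

definition PGammaU_action ::
    "('a::field ^ 'd \<Rightarrow> 'a ^ 'd \<Rightarrow> 'a) \<Rightarrow> nat \<Rightarrow>
     ('a ^ 'd \<Rightarrow> 'a ^ 'd) set \<Rightarrow> ('a ^ 'd) set \<Rightarrow> ('a ^ 'd) set" where
  "PGammaU_action B k S = (\<lambda>U\<in>totally_isotropic B k. the_elem ((\<lambda>f. f ` U) ` S))"

end

theory Submission
  imports Defs "HOL-Computational_Algebra.Polynomial" "HOL-Number_Theory.Residues"
begin

text \<open>
  Take for \<open>Y\<close> the pencil of all \<open>k\<close>-subspaces through a fixed isotropic point and for \<open>X\<close> the
  multiset \<open>1 + P - M\<close>, where \<open>P\<close> and \<open>M\<close> are disjoint sets of totally isotropic \<open>k\<close>-subspaces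
  that cover every point equally often. Then \<open>|X| = |\<Omega>|\<close> and \<open>|X \<star> Y\<^sup>g| = |Y|\<close> for all \<open>g\<close>.

  To find \<open>P\<close> and \<open>M\<close>, fix a totally isotropic \<open>(k - 2)\<close>-space \<open>S\<close> and, in \<open>S\<^sup>\<bottom>\<close>, an isotropic
  vector \<open>p\<close> together with a hyperbolic pair \<open>a\<close>, \<open>b\<close> orthogonal to \<open>p\<close>. An isotropic \<open>x\<close> in \<open>S\<^sup>\<bottom>\<close>
  with \<open>B x p = 1\<close> lies in exactly one totally isotropic subspace that contains \<open>S\<close> and a point of
  the line \<open>\<langle>p, a\<rangle>\<close> modulo \<open>S\<close>, and likewise for \<open>b\<close>. Letting \<open>x\<close> run over two level sets
  \<open>\<Xi>\<^sub>0\<close>, \<open>\<Xi>\<^sub>1\<close> of \<open>B x v\<close>, where \<open>v\<close> is orthogonal to \<open>S\<close>, \<open>p\<close>, \<open>a\<close>, \<open>b\<close> and has norm 1, gives four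
  families \<open>a\<Xi>\<^sub>0\<close>, \<open>a\<Xi>\<^sub>1\<close>, \<open>b\<Xi>\<^sub>0\<close>, \<open>b\<Xi>\<^sub>1\<close>. Points off \<open>p\<^sup>\<bottom>\<close> do not distinguish \<open>a\<Xi>\<^sub>i\<close> from \<open>b\<Xi>\<^sub>i\<close>;
  points of \<open>p\<^sup>\<bottom>\<close> do not distinguish \<open>a\<Xi>\<^sub>0\<close> from \<open>a\<Xi>\<^sub>1\<close>, nor \<open>b\<Xi>\<^sub>0\<close> from \<open>b\<Xi>\<^sub>1\<close>. Hence
  \<open>P = b\<Xi>\<^sub>0 \<union> a\<Xi>\<^sub>1\<close> and \<open>M = a\<Xi>\<^sub>0 \<union> b\<Xi>\<^sub>1\<close> work.
\<close>

section \<open>Hermitian spaces over finite fields\<close>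

text \<open>Bounds the fixed field of \<open>x \<mapsto> x ^ q\<close> and the fibres of the trace
  and norm maps. The assumption \<open>m > 1\<close> keeps the linear term away from the leading
  coefficient.\<close>

lemma card_trinomial_roots_le:
  fixes c e :: "'a::field"
  assumes "m > 1"
  shows "card {x. x ^ m + c * x + e = 0} \<le> m"
proof -
  let ?p = "Polynomial.monom 1 m + [:e, c:]"
  have d: "degree ?p = m"
    using assms by (subst degree_add_eq_left) (simp_all add: degree_monom_eq)
  then have "?p \<noteq> 0"
    using assms by auto
  then have "card {x. poly ?p x = 0} \<le> m"
    using card_poly_roots_bound d by metis
  then show ?thesis
    by (simp add: poly_monom algebra_simps)
qed

locale hermitian_space =
  fixes B :: "'a::{field,finite} ^ 'd \<Rightarrow> 'a ^ 'd \<Rightarrow> 'a" and q :: nat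
  assumes primepow_q: "primepow q"
    and card_field: "CARD('a) = q\<^sup>2"
    and herm: "hermitian_form q B"
    and nondeg: "nondegenerate B"
begin

lemma q_gt_1: "q > 1"
  using primepow_q by (rule primepow_gt_Suc_0[unfolded One_nat_def[symmetric]])

text \<open>The characteristic divides \<open>CARD('a)\<close>, a power of the prime underlying
  \<open>q\<close>, so it is that prime and the freshman's dream applies.\<close>

lemma frobenius_add: "(x + y :: 'a) ^ q = x ^ q + y ^ q"
proof -
  obtain p e where p: "prime p" "e > 0" "q = p ^ e"
    using primepow_q by (auto simp: primepow_def)
  have c: "prime CHAR('a)"
    by (rule prime_CHAR_semidom, rule finite_imp_CHAR_pos) simp
  have "CHAR('a) dvd (p ^ e)\<^sup>2"
    using CHAR_dvd_CARD[where 'a='a] card_field p(3) by simp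
  then have "CHAR('a) = p"
    using c p(1) by (meson prime_dvd_power primes_dvd_imp_eq)
  then show ?thesis
    using freshmans_dream'[OF c] p(3) by blast
qed

lemma B_add: "B (u + v) w = B u w + B v w"
  and B_scale: "B (c *s u) v = c * B u v"
  and B_conj: "B v u = B u v ^ q"
  using herm unfolding hermitian_form_def by blast+

lemma B_add': "B w (u + v) = B w u + B w v"
  by (subst (1 2 3) B_conj) (simp add: B_add frobenius_add)

lemma B_scale': "B u (c *s v) = c ^ q * B u v"
  by (subst (1 2) B_conj) (simp add: B_scale power_mult_distrib)

lemma B_zero [simp]: "B 0 v = 0" "B v 0 = 0"
proof -
  show "B 0 v = 0" using B_scale[of 0 0 v] by simp
  then show "B v 0 = 0" using B_conj[of 0 v] q_gt_1 by simp
qed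

lemma B_diff: "B (u - v) w = B u w - B v w"
  using B_add[of "u - v" v w] by (simp add: algebra_simps)

lemma B_diff': "B w (u - v) = B w u - B w v"
  using B_add'[of w "u - v" v] by (simp add: algebra_simps)

lemma B_sum: "B (sum f I) w = (\<Sum>i\<in>I. B (f i) w)"
  by (induction I rule: infinite_finite_induct) (simp_all add: B_add)

lemma B_sum': "B w (sum f I) = (\<Sum>i\<in>I. B w (f i))"
  by (induction I rule: infinite_finite_induct) (simp_all add: B_add')

lemmas B_simps = B_add B_add' B_scale B_scale' B_diff B_diff'

lemma B_eq_0_commute: "B u v = 0 \<longleftrightarrow> B v u = 0"
  using B_conj[of u v] B_conj[of v u] q_gt_1 by (metis power_eq_0_iff)

lemma exists_B_neq_0: "u \<noteq> 0 \<Longrightarrow> \<exists>v. B u v \<noteq> 0"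
  using nondeg by (auto simp: nondegenerate_def)

lemma subspace_perp: "vec.subspace {u. B u w = 0}"
  by (auto simp: vec.subspace_def B_add B_scale)

lemma span_perp: "u \<in> vec.span S \<Longrightarrow> (\<And>s. s \<in> S \<Longrightarrow> B s w = 0) \<Longrightarrow> B u w = 0"
  using vec.span_minimal[OF _ subspace_perp, of S w] by auto

text \<open>
  Nondegeneracy makes \<open>B\<close> surjective, so the Hermitian symmetry already forces \<open>x \<mapsto> x ^ q\<close>
  to be an involution.
\<close>

lemma frobenius_frobenius [simp]: "((x::'a) ^ q) ^ q = x"
proof -
  obtain u v where uv: "B u v \<noteq> 0"
    using exists_B_neq_0[of 1] by auto
  have "B ((x / B u v) *s u) v = x"
    using uv by (simp add: B_scale)
  then show ?thesis
    using B_conj by metis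
qed

lemma frobenius_minus: "(- x :: 'a) ^ q = - (x ^ q)"
  using frobenius_add[of "- x" x] q_gt_1 by (simp add: eq_neg_iff_add_eq_0 power_0_left)

section \<open>Trace and norm onto the fixed field of \<open>x \<mapsto> x ^ q\<close>\<close>

lemma card_fixed_field_le: "card {x::'a. x ^ q = x} \<le> q"
  using card_trinomial_roots_le[of q "- 1" 0] q_gt_1 by simp

text \<open>Counting: the \<open>q * q\<close> field elements fall into fibres of size at most
  \<open>q\<close>, so the trace takes at least \<open>q\<close> values, all in a fixed field of at
  most \<open>q\<close> elements.\<close>

lemma trace_surj:
  assumes "(t::'a) ^ q = t"
  shows "\<exists>x. x + x ^ q = t"
proof -
  let ?T = "\<lambda>x::'a. x + x ^ q" and ?F = "{x::'a. x ^ q = x}"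
  have fib: "card {x \<in> UNIV. ?T x = y} \<le> q" for y
    using card_trinomial_roots_le[of q 1 "- y"] q_gt_1 by (simp add: algebra_simps)
  have "q * q = card (UNIV :: 'a set)"
    using card_field by (simp add: power2_eq_square)
  also have "UNIV = (\<Union>y\<in>range ?T. {x \<in> UNIV. ?T x = y})"
    by auto
  also have "card \<dots> \<le> (\<Sum>y\<in>range ?T. card {x \<in> UNIV. ?T x = y})"
    by (rule card_UN_le) simp
  also have "\<dots> \<le> card (range ?T) * q"
    using sum_bounded_above[of "range ?T" _ q] fib by simp
  finally have "card (range ?T) \<ge> q"
    using q_gt_1 by simp
  moreover have "range ?T \<subseteq> ?F"
    by (auto simp: frobenius_add add.commute)
  ultimately have "range ?T = ?F"
    using card_fixed_field_le by (intro card_seteq) auto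
  then show ?thesis
    using assms by (metis (mono_tags, lifting) mem_Collect_eq rangeE)
qed

text \<open>The same count on the units: \<open>(q - 1) * (q + 1)\<close> elements in fibres of size
  at most \<open>q + 1\<close> give at least \<open>q - 1\<close> norms, which must exhaust the
  nonzero fixed elements.\<close>

lemma norm_surj:
  assumes "(t::'a) ^ q = t"
  shows "\<exists>x. x * x ^ q = t"
proof -
  let ?N = "\<lambda>x::'a. x * x ^ q" and ?F = "{x::'a. x ^ q = x} - {0}"
  have fib: "card {x \<in> UNIV - {0}. ?N x = y} \<le> q + 1" for y
  proof -
    have "card {x \<in> UNIV - {0}. ?N x = y} \<le> card {x. x ^ (q + 1) + 0 * x + (- y) = 0}"
      by (intro card_mono) auto
    also have "\<dots> \<le> q + 1"
      using q_gt_1 by (intro card_trinomial_roots_le) simp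
    finally show ?thesis .
  qed
  have "(q - 1) * (q + 1) = card (UNIV - {0} :: 'a set)"
    using card_field q_gt_1 by (simp add: card_Diff_singleton power2_eq_square algebra_simps)
  also have "UNIV - {0} = (\<Union>y\<in>?N ` (UNIV - {0}). {x \<in> UNIV - {0}. ?N x = y})"
    by auto
  also have "card \<dots> \<le> (\<Sum>y\<in>?N ` (UNIV - {0}). card {x \<in> UNIV - {0}. ?N x = y})"
    by (rule card_UN_le) simp
  also have "\<dots> \<le> card (?N ` (UNIV - {0})) * (q + 1)"
    using sum_bounded_above[of "?N ` (UNIV - {0})" _ "q + 1"] fib by simp
  finally have "card (?N ` (UNIV - {0})) \<ge> q - 1"
    by (simp only: mult_le_cancel2)
  moreover have "card ?F \<le> q - 1"
    using card_fixed_field_le q_gt_1 by (subst card_Diff_singleton) auto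
  moreover have "?N ` (UNIV - {0}) \<subseteq> ?F"
    by (auto simp: power_mult_distrib mult.commute)
  ultimately have eq: "?N ` (UNIV - {0}) = ?F"
    by (intro card_seteq) auto
  show ?thesis
  proof (cases "t = 0")
    case False
    then have "t \<in> ?N ` (UNIV - {0})"
      using assms eq by simp
    then show ?thesis by auto
  qed (use q_gt_1 in auto)
qed

lemma exists_norm_minus_1: "\<exists>\<alpha>::'a. \<alpha> * \<alpha> ^ q = - 1"
  by (intro norm_surj) (simp add: frobenius_minus)

lemma B_self_fixed: "B u u ^ q = B u u"
  using B_conj[of u u] by simp

section \<open>Orthonormal bases and totally isotropic subspaces\<close>

text \<open>Independence is read off a triangular pattern of form values: \<open>w\<close> is
  orthogonal to all earlier vectors but not to \<open>s i\<close>, so \<open>s i\<close> lies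
  outside their span.\<close>

lemma dim_triangular:
  assumes "\<And>i. i < m \<Longrightarrow> \<exists>w. B (s i) w \<noteq> 0 \<and> (\<forall>j<i. B (s j) w = 0)"
  shows "vec.dim (s ` {..<m}) = m"
  using assms
proof (induction m)
  case (Suc m)
  obtain w where w: "B (s m) w \<noteq> 0" "\<forall>j<m. B (s j) w = 0"
    using Suc.prems by blast
  have "s m \<notin> vec.span (s ` {..<m})"
    using span_perp[of "s m" "s ` {..<m}" w] w by auto
  then show ?case
    using Suc by (simp add: lessThan_Suc vec.dim_insert)
qed simp

section \<open>Orthonormal systems, their extension and their isometries\<close>

definition orthonormal :: "(nat \<Rightarrow> 'a ^ 'd) \<Rightarrow> nat \<Rightarrow> bool" where
  "orthonormal x m \<longleftrightarrow> (\<forall>i<m. \<forall>j<m. B (x i) (x j) = (if i = j then 1 else 0))"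

lemma orthonormalD:
  "orthonormal x m \<Longrightarrow> i < m \<Longrightarrow> j < m \<Longrightarrow> B (x i) (x j) = (if i = j then 1 else 0)"
  by (auto simp: orthonormal_def)

lemma orthonormal_mono: "orthonormal x m \<Longrightarrow> l \<le> m \<Longrightarrow> orthonormal x l"
  by (auto simp: orthonormal_def)

lemma dim_orthonormal: "orthonormal x m \<Longrightarrow> vec.dim (x ` {..<m}) = m"
proof (rule dim_triangular)
  fix i assume "orthonormal x m" "i < m"
  then show "\<exists>w. B (x i) w \<noteq> 0 \<and> (\<forall>j<i. B (x j) w = 0)"
    by (intro exI[of _ "x i"]) (auto simp: orthonormalD)
qed

lemma orthonormal_le_CARD: "orthonormal x m \<Longrightarrow> m \<le> CARD('d)"
  using dim_orthonormal dim_subset_UNIV_cart_gen[of "x ` {..<m}"] by simp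

definition proj_perp :: "(nat \<Rightarrow> 'a ^ 'd) \<Rightarrow> nat \<Rightarrow> 'a ^ 'd \<Rightarrow> 'a ^ 'd" where
  "proj_perp x m u = u - (\<Sum>i<m. B u (x i) *s x i)"

lemma proj_perp_orthogonal:
  assumes "orthonormal x m" "l < m"
  shows "B (proj_perp x m u) (x l) = 0"
proof -
  have "(\<Sum>i<m. B u (x i) * B (x i) (x l)) = (\<Sum>i<m. if i = l then B u (x i) else 0)"
    using assms by (intro sum.cong) (auto simp: orthonormalD)
  then show ?thesis
    using assms(2) by (simp add: proj_perp_def B_diff B_sum B_scale)
qed

lemma B_proj_perp:
  assumes "\<And>i. i < m \<Longrightarrow> B w (x i) = 0"
  shows "B (proj_perp x m u) w = B u w"
  using assms B_eq_0_commute[of w] by (simp add: proj_perp_def B_diff B_sum B_scale)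

lemma orthonormal_extend:
  assumes "orthonormal x m" "\<And>i. i < m \<Longrightarrow> B y (x i) = 0" "B y y = 1"
  shows "orthonormal (x(m := y)) (Suc m)"
  using assms B_eq_0_commute[of y] by (auto simp: orthonormal_def less_Suc_eq)

text \<open>The Gram-Schmidt remainder is orthogonal to a spanning set, hence zero by
  nondegeneracy.\<close>

lemma orthonormal_expansion:
  assumes "orthonormal x CARD('d)"
  shows "(\<Sum>i<CARD('d). B u (x i) *s x i) = u"
proof -
  have span: "vec.span (x ` {..<CARD('d)}) = UNIV"
    using dim_orthonormal[OF assms] vec.dim_eq_full[of "x ` {..<CARD('d)}"]
    by (simp add: vec.dim_UNIV card_cart_basis vec.dimension_def)
  let ?w = "proj_perp x CARD('d) u"
  have "B v ?w = 0" for v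
    using span span_perp[of v "x ` {..<CARD('d)}" ?w] proj_perp_orthogonal[OF assms]
      B_eq_0_commute by blast
  then have "?w = 0"
    using exists_B_neq_0 B_eq_0_commute by blast
  then show ?thesis
    by (simp add: proj_perp_def)
qed

text \<open>\<open>B y y\<close> lies in the fixed field, so its inverse is a norm.\<close>

lemma exists_norm_1:
  assumes "B y y \<noteq> 0"
  shows "\<exists>c. B (c *s y) (c *s y) = 1"
proof -
  obtain c where "c * c ^ q = 1 / B y y"
    using norm_surj[of "1 / B y y"] by (auto simp: power_divide B_self_fixed)
  moreover have "B (c *s y) (c *s y) = c * c ^ q * B y y"
    by (simp add: B_scale B_scale')
  ultimately show ?thesis
    using assms by (intro exI[of _ c]) simp
qed

text \<open>It suffices to find a non-isotropic vector in the orthogonal complement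
  \<open>?W\<close>, since it can be rescaled to norm 1. Polarisation shows that \<open>?W\<close>
  cannot consist of isotropic vectors only.\<close>

lemma orthonormal_step:
  assumes "orthonormal x m" "m < CARD('d)"
  shows "\<exists>y. orthonormal (x(m := y)) (Suc m)"
proof -
  let ?W = "{w. \<forall>i<m. B w (x i) = 0}"
  have "vec.dim (vec.span (x ` {..<m})) < CARD('d)"
    using dim_orthonormal[OF assms(1)] assms(2) by simp
  then obtain u where u: "u \<notin> vec.span (x ` {..<m})"
    by (metis UNIV_eq_I less_irrefl vec_dim_card)
  define w where "w = proj_perp x m u"
  have "(\<Sum>i<m. B u (x i) *s x i) \<in> vec.span (x ` {..<m})"
    by (intro vec.span_sum vec.span_scale vec.span_base) auto
  then have w0: "w \<noteq> 0"
    using u by (auto simp: w_def proj_perp_def)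
  have wW: "w \<in> ?W"
    using proj_perp_orthogonal[OF assms(1)] by (auto simp: w_def)
  obtain v where v: "B w v \<noteq> 0"
    using exists_B_neq_0 w0 by blast
  \<comment> \<open>Projecting \<open>v\<close> into \<open>?W\<close> does not change its product
    with \<open>w\<close>, which is already in \<open>?W\<close>.\<close>
  define z where "z = proj_perp x m v"
  have zW: "z \<in> ?W"
    using proj_perp_orthogonal[OF assms(1)] by (auto simp: z_def)
  have zw: "B z w \<noteq> 0"
    using v wW B_proj_perp[of m w x v] B_eq_0_commute by (auto simp: z_def)
  have "\<exists>y\<in>?W. B y y \<noteq> 0"
  proof (rule ccontr)
    assume "\<not> ?thesis"
    then have iso: "B y y = 0" if "y \<in> ?W" for y
      using that by blast
    \<comment> \<open>A scalar of trace 1: with \<open>c = t / B z w\<close> the isotropic vector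
      \<open>w + c *s z\<close> would have norm \<open>t + t ^ q = 1\<close>.\<close>
    obtain t :: 'a where t: "t + t ^ q = 1"
      using trace_surj[of 1] by auto
    define c where "c = t / B z w"
    have "w + c *s z \<in> ?W"
      using wW zW by (simp add: B_add B_scale)
    from iso[OF this] have "c * B z w + (c * B z w) ^ q = 0"
      using iso[OF wW] iso[OF zW] B_conj[of w z]
      by (simp add: B_simps power_mult_distrib add.commute)
    then show False
      using t zw by (simp add: c_def)
  qed
  then obtain y where y: "y \<in> ?W" "B y y \<noteq> 0" by blast
  then obtain c where "B (c *s y) (c *s y) = 1"
    using exists_norm_1 by blast
  then show ?thesis
    using orthonormal_extend[OF assms(1), of "c *s y"] y by (auto simp: B_scale)
qed

lemma orthonormal_complete:
  assumes "orthonormal x m"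
  shows "\<exists>y. orthonormal y CARD('d) \<and> (\<forall>i<m. y i = x i)"
  using assms
proof (induction "CARD('d) - m" arbitrary: x m)
  case 0
  then show ?case
    using orthonormal_le_CARD[of x m] by (metis diff_is_0_eq le_antisym)
next
  case (Suc l)
  then obtain y where y: "orthonormal (x(m := y)) (Suc m)"
    using orthonormal_step[of x m] by (metis zero_less_Suc zero_less_diff)
  have "l = CARD('d) - Suc m"
    using Suc(2) by simp
  from Suc(1)[OF this y] obtain z
    where "orthonormal z CARD('d)" "\<forall>i<Suc m. z i = (x(m := y)) i"
    by blast
  then show ?case
    by (metis fun_upd_other less_Suc_eq less_irrefl)
qed

text \<open>The map transferring coordinates is an isometry, that is, a semisimilarity with trivial
  automorphism and factor 1. Linearity is recorded so that images of spans can be computed.\<close>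

lemma orthonormal_isometry:
  assumes x: "orthonormal x CARD('d)" and y: "orthonormal y CARD('d)"
  shows "\<exists>f. semisimilarity B f \<and> Vector_Spaces.linear (*s) (*s) f \<and> (\<forall>i<CARD('d). f (x i) = y i)"
proof -
  let ?N = "CARD('d)"
  define f where "f u = (\<Sum>i<?N. B u (x i) *s y i)" for u
  have add: "f (u + v) = f u + f v" for u v
    by (simp add: f_def B_add vec.scale_left_distrib sum.distrib)
  have scale: "f (c *s u) = c *s f u" for c u
    by (simp add: f_def B_scale vec.scale_sum_right vec.scale_scale)
  have lin: "Vector_Spaces.linear (*s) (*s) f"
    by (simp add: Vector_Spaces.linear_iff vec.vector_space_axioms add scale)
  have By: "B (f u) (y j) = B u (x j)" if "j < ?N" for u j
  proof -
    have "B (f u) (y j) = (\<Sum>i<?N. if i = j then B u (x i) else 0)"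
      unfolding f_def B_sum B_scale using y that by (intro sum.cong) (auto simp: orthonormalD)
    then show ?thesis
      using that by simp
  qed
  have iso: "B (f u) (f v) = B u v" for u v
  proof -
    have "B (f u) (f v) = (\<Sum>i<?N. B v (x i) ^ q * B u (x i))"
      by (subst (2) f_def) (simp add: B_sum' B_scale' By)
    also have "\<dots> = B u (\<Sum>i<?N. B v (x i) *s x i)"
      by (simp add: B_sum' B_scale')
    finally show ?thesis
      by (simp add: orthonormal_expansion[OF x])
  qed
  have "inj f"
  proof (rule injI)
    fix u v assume "f u = f v"
    then have "f (u - v) = 0"
      using add[of "u - v" v] by simp
    then show "u = v"
      using iso[of "u - v"] exists_B_neq_0[of "u - v"] by auto
  qed
  then have "bij f"
    by (simp add: bij_def finite_UNIV_inj_surj)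
  then have "semisimilarity B f"
    unfolding semisimilarity_def field_automorphism_def using add scale iso
    by (intro conjI allI exI[of _ id] exI[of _ 1]) auto
  moreover have "f (x i) = y i" if "i < ?N" for i
  proof -
    have "f (x i) = (\<Sum>j<?N. if j = i then y j else 0)"
      unfolding f_def using x that by (intro sum.cong) (auto simp: orthonormalD)
    then show ?thesis
      using that by simp
  qed
  ultimately show ?thesis
    using lin by blast
qed

section \<open>Isotropic vectors from orthonormal pairs, and transitivity\<close>

text \<open>For \<alpha> of norm -1 and an orthonormal \<open>x\<close> the norm is
  \<open>1 + \<alpha> * \<alpha> ^ q = 0\<close>. Each index uses its own pair of basis vectors, so
  different indices give orthogonal vectors.\<close>

definition iso_vec :: "'a \<Rightarrow> (nat \<Rightarrow> 'a ^ 'd) \<Rightarrow> nat \<Rightarrow> 'a ^ 'd" where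
  "iso_vec \<alpha> x i = x (2 * i) + \<alpha> *s x (2 * i + 1)"

lemma dim_iso_vec:
  assumes "orthonormal x (2 * j)"
  shows "vec.dim (iso_vec \<alpha> x ` {..<j}) = j"
proof (rule dim_triangular)
  fix i assume "i < j"
  then show "\<exists>w. B (iso_vec \<alpha> x i) w \<noteq> 0 \<and> (\<forall>l<i. B (iso_vec \<alpha> x l) w = 0)"
    using assms by (intro exI[of _ "x (2 * i)"]) (auto simp: iso_vec_def B_simps orthonormalD)
qed

lemma iso_vec_isotropic:
  assumes "orthonormal x (2 * j)" "\<alpha> * \<alpha> ^ q = -1" "i < j" "l < j"
  shows "B (iso_vec \<alpha> x i) (iso_vec \<alpha> x l) = 0"
proof -
  have "2 * l \<noteq> Suc (2 * i)" "2 * i \<noteq> Suc (2 * l)" by presburger+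
  then show ?thesis
    using assms by (auto simp: iso_vec_def B_simps orthonormalD mult.commute[of "\<alpha> ^ q"])
qed

lemma totally_isotropicD:
  assumes "U \<in> totally_isotropic B k"
  shows "vec.subspace U" "vec.dim U = k" "\<And>u v. u \<in> U \<Longrightarrow> v \<in> U \<Longrightarrow> B u v = 0"
  using assms by (auto simp: totally_isotropic_def)

text \<open>Orthogonality to the \<open>iso_vec\<close> forces the coefficient at
  \<open>x (2 * i + 1)\<close> to be \<alpha> times that at \<open>x (2 * i)\<close>. The terms
  subtracted by the projection thus pair up, so projecting a vector of a subspace containing the
  \<open>iso_vec\<close> does not leave that subspace.\<close>

lemma proj_perp_iso_vec:
  assumes \<alpha>: "\<alpha> * \<alpha> ^ q = -1" and perp: "\<And>i. i < j \<Longrightarrow> B u (iso_vec \<alpha> x i) = 0"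
  shows "proj_perp x (2 * j) u = u - (\<Sum>i<j. B u (x (2 * i)) *s iso_vec \<alpha> x i)"
proof -
  have "(\<Sum>i<2 * j. B u (x i) *s x i) = (\<Sum>i<j. B u (x (2 * i)) *s iso_vec \<alpha> x i)"
    using perp
  proof (induction j)
    case (Suc j)
    have "B u (x (2 * j)) + \<alpha> ^ q * B u (x (2 * j + 1)) = 0"
      using Suc.prems[of j] by (simp add: iso_vec_def B_simps)
    then have "\<alpha> * B u (x (2 * j)) = - (\<alpha> * \<alpha> ^ q) * B u (x (2 * j + 1))"
      by (simp add: eq_neg_iff_add_eq_0[symmetric] add_eq_0_iff mult.assoc)
    then have "B u (x (2 * j + 1)) = B u (x (2 * j)) * \<alpha>"
      using \<alpha> by (simp add: mult.commute)
    then show ?case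
      using Suc by (simp add: iso_vec_def vec.scale_right_distrib vec.scale_scale add.assoc)
  qed simp
  then show ?thesis
    by (simp add: proj_perp_def)
qed

text \<open>
  This replaces Witt's theorem: every totally isotropic subspace is spanned by the vectors
  \<^term>\<open>iso_vec \<alpha> x i\<close> of an orthonormal basis, so orthonormal bases can be matched instead.
\<close>

lemma totally_isotropic_orthonormal_vectors:
  assumes U: "U \<in> totally_isotropic B k" and \<alpha>: "\<alpha> * \<alpha> ^ q = -1" and "j \<le> k"
  shows "\<exists>x. orthonormal x (2 * j) \<and> (\<forall>i<j. iso_vec \<alpha> x i \<in> U)"
  using \<open>j \<le> k\<close>
proof (induction j)
  case 0
  then show ?case by (simp add: orthonormal_def)
next
  case (Suc j)
  then obtain x where x: "orthonormal x (2 * j)" and s: "\<And>i. i < j \<Longrightarrow> iso_vec \<alpha> x i \<in> U"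
    by auto
  note U' = totally_isotropicD[OF U]
  have span: "vec.span (iso_vec \<alpha> x ` {..<j}) \<subseteq> U"
    using s U'(1) by (intro vec.span_minimal) auto
  moreover have "vec.dim (vec.span (iso_vec \<alpha> x ` {..<j})) \<noteq> vec.dim U"
    using dim_iso_vec[OF x, of \<alpha>] U'(2) Suc.prems by simp
  ultimately obtain u where u: "u \<in> U" "u \<notin> vec.span (iso_vec \<alpha> x ` {..<j})"
    by (metis subset_antisym subset_iff)
  \<comment> \<open>A new vector of \<open>U\<close>, made orthogonal to the system built so far; it
    is to become the next \<open>iso_vec\<close>.\<close>
  define e where "e = proj_perp x (2 * j) u"
  have e_eq: "e = u - (\<Sum>i<j. B u (x (2 * i)) *s iso_vec \<alpha> x i)"
    unfolding e_def using U'(3) s u(1) by (intro proj_perp_iso_vec[OF \<alpha>]) auto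
  have sum: "(\<Sum>i<j. B u (x (2 * i)) *s iso_vec \<alpha> x i) \<in> vec.span (iso_vec \<alpha> x ` {..<j})"
    by (intro vec.span_sum vec.span_scale vec.span_base) auto
  then have e0: "e \<noteq> 0"
    using u(2) by (auto simp: e_eq)
  have eU: "e \<in> U"
    using sum span u(1) U'(1) unfolding e_eq by (intro vec.subspace_diff) auto
  then have ee: "B e e = 0"
    using U'(3) by blast
  have ex: "B e (x i) = 0" if "i < 2 * j" for i
    using proj_perp_orthogonal[OF x that] by (simp add: e_def)
  obtain v where v: "B v e \<noteq> 0"
    using exists_B_neq_0[OF e0] B_eq_0_commute by blast
  \<comment> \<open>A partner of \<open>e\<close> orthogonal to the system, normalised to
    \<open>B y e = 1\<close>.\<close>
  define y where "y = (1 / B v e) *s proj_perp x (2 * j) v"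
  have ye: "B y e = 1"
    using v B_proj_perp[of "2 * j" e x v] ex by (simp add: y_def B_scale)
  have ey: "B e y = 1"
    using B_conj[of e y] ye by simp
  have yx: "B y (x i) = 0" if "i < 2 * j" for i
    using proj_perp_orthogonal[OF x that] by (simp add: y_def B_scale)
  \<comment> \<open>Adding \<open>c *s e\<close> to \<open>y\<close> changes the norm by
    \<open>c + c ^ q\<close>, so this choice gives \<open>y1\<close> norm 1.\<close>
  obtain c where c: "c + c ^ q = 1 - B y y"
    using trace_surj[of "1 - B y y"] frobenius_add[of "1 - B y y" "B y y"]
    by (auto simp: B_self_fixed eq_diff_eq)
  define y1 where "y1 = y + c *s e"
  \<comment> \<open>Solves \<open>y1 + \<alpha> *s y2 = e\<close>. As \<open>e - y1\<close> has norm
    -1, like \<alpha>, the quotient has norm 1.\<close>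
  define y2 where "y2 = (1 / \<alpha>) *s (e - y1)"
  have \<alpha>0: "\<alpha> \<noteq> 0"
    using \<alpha> by auto
  have y1e: "B y1 e = 1" "B e y1 = 1"
    using ye ey ee by (simp_all add: y1_def B_simps)
  have y11: "B y1 y1 = 1"
    using ye ey ee c by (simp add: y1_def B_simps algebra_simps)
  have y22: "B y2 y2 = 1"
  proof -
    have "B (e - y1) (e - y1) = -1"
      using y1e ee y11 by (simp add: B_simps)
    then have "B y2 y2 = - 1 / (\<alpha> * \<alpha> ^ q)"
      unfolding y2_def B_scale B_scale' by (simp add: power_divide)
    then show ?thesis
      using \<alpha> by simp
  qed
  have y12: "B y2 y1 = 0"
    using y1e y11 by (simp add: y2_def B_simps)
  have y1x: "B y1 (x i) = 0" if "i < 2 * j" for i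
    using yx ex that by (simp add: y1_def B_simps)
  have y2x: "B y2 (x i) = 0" if "i < 2 * j" for i
    using y1x ex that by (simp add: y2_def B_simps)
  have o1: "orthonormal (x(2 * j := y1)) (Suc (2 * j))"
    using x y11 y1x by (intro orthonormal_extend)
  have o2: "orthonormal ((x(2 * j := y1))(Suc (2 * j) := y2)) (Suc (Suc (2 * j)))"
    using y22 y12 y2x by (intro orthonormal_extend[OF o1]) (auto simp: less_Suc_eq)
  have "iso_vec \<alpha> ((x(2 * j := y1))(Suc (2 * j) := y2)) i \<in> U" if "i < Suc j" for i
  proof (cases "i = j")
    case True
    then show ?thesis
      using eU \<alpha>0 by (simp add: iso_vec_def y2_def vec.scale_scale)
  next
    case False
    then show ?thesis
      using that s[of i] by (simp add: iso_vec_def)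
  qed
  moreover have "2 * Suc j = Suc (Suc (2 * j))"
    by simp
  ultimately show ?case
    using o2 by metis
qed

text \<open>The \<open>k\<close> independent vectors found in \<open>U\<close> span it by dimension;
  completing the system to a full basis leaves them unchanged.\<close>

lemma totally_isotropic_orthonormal_basis:
  assumes U: "U \<in> totally_isotropic B k" and \<alpha>: "\<alpha> * \<alpha> ^ q = -1"
  shows "\<exists>x. orthonormal x CARD('d) \<and> 2 * k \<le> CARD('d) \<and> U = vec.span (iso_vec \<alpha> x ` {..<k})"
proof -
  obtain x where x: "orthonormal x (2 * k)" and s: "\<forall>i<k. iso_vec \<alpha> x i \<in> U"
    using totally_isotropic_orthonormal_vectors[OF U \<alpha>, of k] by auto
  have "vec.span (iso_vec \<alpha> x ` {..<k}) = U"
    using s totally_isotropicD[OF U] dim_iso_vec[OF x, of \<alpha>]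
    by (intro vec.subspace_dim_equal vec.subspace_span vec.span_minimal) auto
  moreover obtain y where y: "orthonormal y CARD('d)" "\<forall>i<2 * k. y i = x i"
    using orthonormal_complete[OF x] by blast
  moreover have "iso_vec \<alpha> y ` {..<k} = iso_vec \<alpha> x ` {..<k}"
    using y(2) by (intro image_cong) (auto simp: iso_vec_def)
  ultimately show ?thesis
    using orthonormal_le_CARD[OF x] by metis
qed

text \<open>With the same \<alpha> on both sides, the isometry matching the two orthonormal bases
  sends each \<open>iso_vec\<close> of \<open>U\<close> to the corresponding one of
  \<open>V\<close>.\<close>

lemma totally_isotropic_transitive:
  assumes "U \<in> totally_isotropic B k" "V \<in> totally_isotropic B k"
  shows "\<exists>f. semisimilarity B f \<and> f ` U = V"
proof -
  obtain \<alpha> :: 'a where \<alpha>: "\<alpha> * \<alpha> ^ q = -1"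
    using exists_norm_minus_1 by blast
  obtain x where x: "orthonormal x CARD('d)" "2 * k \<le> CARD('d)" "U = vec.span (iso_vec \<alpha> x ` {..<k})"
    using totally_isotropic_orthonormal_basis[OF assms(1) \<alpha>] by blast
  obtain y where y: "orthonormal y CARD('d)" "V = vec.span (iso_vec \<alpha> y ` {..<k})"
    using totally_isotropic_orthonormal_basis[OF assms(2) \<alpha>] by blast
  obtain f where f: "semisimilarity B f" "Vector_Spaces.linear (*s) (*s) f"
      "\<forall>i<CARD('d). f (x i) = y i"
    using orthonormal_isometry[OF x(1) y(1)] by blast
  have "f (iso_vec \<alpha> x i) = iso_vec \<alpha> y i" if "i < k" for i
    using f(2,3) x(2) that by (simp add: iso_vec_def Vector_Spaces.linear_iff)
  then have "f ` U = V"
    using x(3) y(2) vec.linear_span_image[OF f(2), of "iso_vec \<alpha> x ` {..<k}"]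
    by (simp add: image_image)
  then show ?thesis
    using f(1) by blast
qed

end

section \<open>Semisimilarities and the action of the projective group\<close>

lemma field_automorphism_comp:
  "field_automorphism \<sigma> \<Longrightarrow> field_automorphism \<tau> \<Longrightarrow> field_automorphism (\<sigma> \<circ> \<tau>)"
  by (auto simp: field_automorphism_def intro: bij_comp)

lemma field_automorphism_inv:
  assumes "field_automorphism \<sigma>"
  shows "field_automorphism (inv_into UNIV \<sigma>)"
proof -
  have "bij \<sigma>" using assms by (simp add: field_automorphism_def)
  then have i: "\<sigma> (inv_into UNIV \<sigma> x) = x" and e: "\<sigma> u = \<sigma> v \<Longrightarrow> u = v" for x u v
    by (auto simp: bij_def surj_f_inv_f inj_eq)
  have "\<sigma> (x + y) = \<sigma> x + \<sigma> y" "\<sigma> (x * y) = \<sigma> x * \<sigma> y" for x y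
    using assms by (simp_all add: field_automorphism_def)
  then show ?thesis
    unfolding field_automorphism_def using \<open>bij \<sigma>\<close>
    by (intro conjI allI bij_imp_bij_inv) (assumption | rule e, simp add: i)+
qed

lemma field_automorphism_eq_0_iff:
  assumes "field_automorphism (\<sigma> :: 'a::field \<Rightarrow> 'a)"
  shows "\<sigma> x = 0 \<longleftrightarrow> x = 0"
proof -
  have "\<sigma> 0 + \<sigma> 0 = \<sigma> 0"
    using assms by (metis add_0 field_automorphism_def)
  then have "\<sigma> 0 = 0" by (metis add_cancel_right_right)
  then show ?thesis
    using assms by (metis bij_def field_automorphism_def injD)
qed

section \<open>Group laws of semisimilarities and their effect on subspaces\<close>

lemma semisimilarity_comp:
  assumes "semisimilarity B f" "semisimilarity B g"
  shows "semisimilarity B (f \<circ> g)"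
proof -
  obtain \<sigma> c \<tau> d where 1: "field_automorphism \<sigma>" "c \<noteq> 0" "\<forall>a v. f (a *s v) = \<sigma> a *s f v"
      "\<forall>u v. B (f u) (f v) = c * \<sigma> (B u v)" "bij f" "\<forall>u v. f (u + v) = f u + f v"
    and 2: "field_automorphism \<tau>" "d \<noteq> 0" "\<forall>a v. g (a *s v) = \<tau> a *s g v"
      "\<forall>u v. B (g u) (g v) = d * \<tau> (B u v)" "bij g" "\<forall>u v. g (u + v) = g u + g v"
    using assms unfolding semisimilarity_def by metis
  have "\<sigma> (x * y) = \<sigma> x * \<sigma> y" for x y
    using 1(1) by (simp add: field_automorphism_def)
  then show ?thesis
    unfolding semisimilarity_def using 1 2
    by (intro conjI allI exI[of _ "\<sigma> \<circ> \<tau>"] exI[of _ "c * \<sigma> d"])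
      (simp_all add: bij_comp field_automorphism_comp field_automorphism_eq_0_iff mult.assoc)
qed

text \<open>Inverting \<open>B u v = c * \<sigma> (B u' v')\<close>, where \<open>u'\<close> and
  \<open>v'\<close> are the preimages, gives the automorphism inverse to \<sigma> and the factor
  obtained from \<open>1 / c\<close> by that inverse.\<close>

lemma semisimilarity_inv:
  assumes "semisimilarity B f"
  shows "semisimilarity B (inv_into UNIV f)"
proof -
  obtain \<sigma> c where f: "field_automorphism \<sigma>" "c \<noteq> 0" "\<forall>a v. f (a *s v) = \<sigma> a *s f v"
      "\<forall>u v. B (f u) (f v) = c * \<sigma> (B u v)" "bij f" "\<forall>u v. f (u + v) = f u + f v"
    using assms unfolding semisimilarity_def by metis
  have fi: "f (inv_into UNIV f x) = x" and fe: "f u = f v \<Longrightarrow> u = v" for x u v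
    using f(5) by (auto simp: bij_def surj_f_inv_f inj_eq)
  have \<sigma>: "bij \<sigma>" "\<And>x y. \<sigma> (x * y) = \<sigma> x * \<sigma> y"
    using f(1) by (simp_all add: field_automorphism_def)
  have si: "\<sigma> (inv_into UNIV \<sigma> x) = x" and se: "\<sigma> u = \<sigma> v \<Longrightarrow> u = v" for x u v
    using \<sigma>(1) by (auto simp: bij_def surj_f_inv_f inj_eq)
  have form: "B (inv_into UNIV f u) (inv_into UNIV f v) = inv_into UNIV \<sigma> (1 / c) * inv_into UNIV \<sigma> (B u v)" for u v
  proof (rule se)
    have "B u v = c * \<sigma> (B (inv_into UNIV f u) (inv_into UNIV f v))"
      using f(4) fi by metis
    then show "\<sigma> (B (inv_into UNIV f u) (inv_into UNIV f v)) = \<sigma> (inv_into UNIV \<sigma> (1 / c) * inv_into UNIV \<sigma> (B u v))"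
      using f(2) by (simp add: \<sigma>(2) si)
  qed
  have "inv_into UNIV \<sigma> (1 / c) \<noteq> 0"
    using field_automorphism_eq_0_iff[OF field_automorphism_inv[OF f(1)]] f(2) by simp
  moreover have "inv_into UNIV f (u + v) = inv_into UNIV f u + inv_into UNIV f v"
    and "inv_into UNIV f (a *s v) = inv_into UNIV \<sigma> a *s inv_into UNIV f v" for u v a
    by (rule fe, simp add: fi f si)+
  ultimately show ?thesis
    unfolding semisimilarity_def using form f(5) field_automorphism_inv[OF f(1)]
    by (intro conjI allI exI[of _ "inv_into UNIV \<sigma>"] exI[of _ "inv_into UNIV \<sigma> (1 / c)"]) (simp_all add: bij_imp_bij_inv)
qed

lemma semisimilarity_id: "semisimilarity B id"
  unfolding semisimilarity_def field_automorphism_def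
  by (intro conjI allI exI[of _ id] exI[of _ 1]) auto

lemma semisimilarity_inj: "semisimilarity B f \<Longrightarrow> inj f"
  by (simp add: semisimilarity_def bij_def)

lemma semisimilarity_subspace:
  assumes "semisimilarity B f" "vec.subspace U"
  shows "vec.subspace (f ` U)"
proof -
  obtain \<sigma> where f: "bij \<sigma>" "\<forall>a v. f (a *s v) = \<sigma> a *s f v" "\<forall>u v. f (u + v) = f u + f v"
    using assms(1) unfolding semisimilarity_def field_automorphism_def by metis
  show ?thesis
  proof (rule vec.subspaceI)
    have "f 0 = 0"
      using f(3) by (metis add.right_neutral add_left_cancel)
    then show "0 \<in> f ` U"
      using vec.subspace_0[OF assms(2)] by (metis image_eqI)
  next
    fix x y assume "x \<in> f ` U" "y \<in> f ` U"
    then show "x + y \<in> f ` U"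
      using f(3) vec.subspace_add[OF assms(2)] by (auto simp flip: f(3)[rule_format])
  next
    fix c x assume "x \<in> f ` U"
    then obtain u where u: "u \<in> U" "x = f u" by blast
    have "c *s x = f (inv_into UNIV \<sigma> c *s u)"
      using f(1,2) u by (simp add: bij_def surj_f_inv_f)
    then show "c *s x \<in> f ` U"
      using vec.subspace_scale[OF assms(2) u(1)] by blast
  qed
qed

lemma semisimilarity_dim_le:
  assumes "semisimilarity B f" "vec.subspace (U :: ('a::{field,finite} ^ 'd) set)"
  shows "vec.dim (f ` U) \<le> vec.dim U"
proof -
  obtain C where C: "C \<subseteq> U" "vec.independent C" "U \<subseteq> vec.span C" "card C = vec.dim U"
    using vec.basis_exists[of U] by blast
  have "vec.subspace (inv_into UNIV f ` vec.span (f ` C))"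
    by (intro semisimilarity_subspace[of B] semisimilarity_inv assms vec.subspace_span)
  moreover have "C \<subseteq> inv_into UNIV f ` vec.span (f ` C)"
    using semisimilarity_inj[OF assms(1)] vec.span_base[of _ "f ` C"] by (force simp: image_iff)
  ultimately have "U \<subseteq> inv_into UNIV f ` vec.span (f ` C)"
    using C(3) vec.span_minimal by blast
  then have "f ` U \<subseteq> vec.span (f ` C)"
    using assms(1) by (auto simp: semisimilarity_def bij_def surj_f_inv_f image_subset_iff subset_iff image_iff)
  then have "vec.dim (f ` U) \<le> card (f ` C)"
    by (intro vec.dim_le_card) auto
  also have "\<dots> \<le> card C"
    by (rule card_image_le) simp
  finally show ?thesis
    using C(4) by simp
qed

lemma semisimilarity_totally_isotropic:
  assumes f: "semisimilarity B f"
    and U: "U \<in> totally_isotropic (B :: 'a::{field,finite} ^ 'd \<Rightarrow> 'a ^ 'd \<Rightarrow> 'a) k"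
  shows "f ` U \<in> totally_isotropic B k"
proof -
  have U': "vec.subspace U" "vec.dim U = k" "\<forall>u\<in>U. \<forall>v\<in>U. B u v = 0"
    using U by (auto simp: totally_isotropic_def)
  obtain \<sigma> c where \<sigma>: "field_automorphism \<sigma>" "\<forall>u v. B (f u) (f v) = c * \<sigma> (B u v)"
    using f unfolding semisimilarity_def by metis
  \<comment> \<open>The bound applied to the inverse map yields the reverse inequality.\<close>
  have "vec.dim (inv_into UNIV f ` f ` U) \<le> vec.dim (f ` U)"
    by (intro semisimilarity_dim_le[of B] semisimilarity_inv f semisimilarity_subspace[OF f] U')
  then have "vec.dim U \<le> vec.dim (f ` U)"
    using semisimilarity_inj[OF f] by (simp add: image_image)
  then show ?thesis
    using U' \<sigma> field_automorphism_eq_0_iff[OF \<sigma>(1)] semisimilarity_dim_le[OF f U'(1)]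
      semisimilarity_subspace[OF f U'(1)] by (auto simp: totally_isotropic_def)
qed

section \<open>The semisimilarity group and its normal subgroup of scalars\<close>

lemma mult_BijGroup_UNIV:
  "bij f \<Longrightarrow> bij g \<Longrightarrow> f \<otimes>\<^bsub>BijGroup UNIV\<^esub> g = f \<circ> g"
  by (auto simp: BijGroup_def Bij_def extensional_def compose_def)

lemma GammaU_simps:
  "carrier (GammaU B) = {f. semisimilarity B f}"
  "\<one>\<^bsub>GammaU B\<^esub> = id"
  "semisimilarity B f \<Longrightarrow> semisimilarity B g \<Longrightarrow> f \<otimes>\<^bsub>GammaU B\<^esub> g = f \<circ> g"
  using mult_BijGroup_UNIV[of f g]
  by (auto simp: GammaU_def semisimilarity_def BijGroup_def)

lemma group_GammaU: "group (GammaU B)"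
proof (rule groupI)
  fix f assume "f \<in> carrier (GammaU B)"
  then have f: "semisimilarity B f" by (simp add: GammaU_simps)
  then have "inv_into UNIV f \<circ> f = id"
    using semisimilarity_inj by (intro inv_o_cancel)
  then show "\<exists>g\<in>carrier (GammaU B). g \<otimes>\<^bsub>GammaU B\<^esub> f = \<one>\<^bsub>GammaU B\<^esub>"
    using f semisimilarity_inv[OF f] by (intro bexI[of _ "inv_into UNIV f"]) (auto simp: GammaU_simps)
qed (auto simp: GammaU_simps semisimilarity_comp semisimilarity_id comp_assoc)

text \<open>This makes the action of a coset of the scalars on subspaces well defined.\<close>

lemma scalar_image_subspace:
  assumes "vec.subspace U" "a \<noteq> 0"
  shows "(\<lambda>v. a *s v) ` U = U"
proof
  show "(\<lambda>v. a *s v) ` U \<subseteq> U"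
    using vec.subspace_scale[OF assms(1)] by auto
  show "U \<subseteq> (\<lambda>v. a *s v) ` U"
  proof
    fix u assume "u \<in> U"
    then have "u = a *s ((1 / a) *s u)" "(1 / a) *s u \<in> U"
      using vec.subspace_scale[OF assms(1)] assms(2) by (auto simp: vec.scale_scale)
    then show "u \<in> (\<lambda>v. a *s v) ` U" by blast
  qed
qed

context hermitian_space begin

lemma semisimilarity_scalar:
  assumes "a \<noteq> 0"
  shows "semisimilarity B (\<lambda>v. a *s v)"
proof -
  have "inj (\<lambda>v::'a ^ 'd. a *s v)"
    using assms by (auto intro!: injI simp: vec.scale_left_imp_eq)
  then have "bij (\<lambda>v::'a ^ 'd. a *s v)"
    by (simp add: bij_def finite_UNIV_inj_surj)
  then show ?thesis
    unfolding semisimilarity_def field_automorphism_def using assms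
    by (intro conjI allI exI[of _ id] exI[of _ "a * a ^ q"])
      (auto simp: vec.scale_right_distrib B_scale B_scale' vec.scale_scale mult.commute)
qed

lemma scalar_maps_r_coset:
  assumes "semisimilarity B f"
  shows "scalar_maps #>\<^bsub>GammaU B\<^esub> f = (\<lambda>a v. a *s f v) ` (- {0})"
proof -
  have "scalar_maps #>\<^bsub>GammaU B\<^esub> f = (\<lambda>a. (\<lambda>v. a *s v) \<otimes>\<^bsub>GammaU B\<^esub> f) ` (- {0})"
    by (auto simp: r_coset_def scalar_maps_def)
  also have "\<dots> = (\<lambda>a v. a *s f v) ` (- {0})"
    using assms by (intro image_cong) (auto simp: GammaU_simps semisimilarity_scalar)
  finally show ?thesis .
qed

lemma scalar_maps_l_coset:
  assumes "semisimilarity B f"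
  shows "f <#\<^bsub>GammaU B\<^esub> scalar_maps = (\<lambda>a v. f (a *s v)) ` (- {0})"
proof -
  have "f <#\<^bsub>GammaU B\<^esub> scalar_maps = (\<lambda>a. f \<otimes>\<^bsub>GammaU B\<^esub> (\<lambda>v. a *s v)) ` (- {0})"
    by (auto simp: l_coset_def scalar_maps_def)
  also have "\<dots> = (\<lambda>a v. f (a *s v)) ` (- {0})"
    using assms by (intro image_cong) (auto simp: GammaU_simps semisimilarity_scalar)
  finally show ?thesis .
qed

lemma scalar_maps_normal: "scalar_maps \<lhd> GammaU B"
proof -
  interpret group "GammaU B" by (rule group_GammaU)
  have sub: "scalar_maps \<subseteq> carrier (GammaU B)"
    by (auto simp: scalar_maps_def GammaU_simps semisimilarity_scalar)
  have comp: "(\<lambda>v. a *s v) \<circ> (\<lambda>v. b *s v) = (\<lambda>v::'a ^ 'd. (a * b) *s v)" for a b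
    by (auto simp: vec.scale_scale)
  have "subgroup scalar_maps (GammaU B)"
  proof (rule subgroupI[OF sub])
    show "scalar_maps \<noteq> {}"
      by (auto simp: scalar_maps_def intro: exI[of _ 1])
  next
    fix h :: "'a ^ 'd \<Rightarrow> 'a ^ 'd" assume "h \<in> scalar_maps"
    then obtain a where a: "a \<noteq> 0" "h = (\<lambda>v. a *s v)"
      by (auto simp: scalar_maps_def)
    have "inv\<^bsub>GammaU B\<^esub> h = (\<lambda>v. (1 / a) *s v)"
      using a by (intro inv_equality)
        (auto simp: GammaU_simps semisimilarity_scalar comp)
    then show "inv\<^bsub>GammaU B\<^esub> h \<in> scalar_maps"
      using a(1) by (auto simp: scalar_maps_def intro!: exI[of _ "1 / a"])
  next
    fix g h :: "'a ^ 'd \<Rightarrow> 'a ^ 'd" assume "g \<in> scalar_maps" "h \<in> scalar_maps"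
    then obtain a b where ab: "a \<noteq> 0" "b \<noteq> 0" "g = (\<lambda>v. a *s v)" "h = (\<lambda>v. b *s v)"
      by (auto simp: scalar_maps_def)
    have "g \<otimes>\<^bsub>GammaU B\<^esub> h = (\<lambda>v. (a * b) *s v)"
      using ab by (simp add: GammaU_simps semisimilarity_scalar comp)
    then show "g \<otimes>\<^bsub>GammaU B\<^esub> h \<in> scalar_maps"
      using ab by (auto simp: scalar_maps_def intro!: exI[of _ "a * b"])
  qed
  moreover have "scalar_maps #>\<^bsub>GammaU B\<^esub> f = f <#\<^bsub>GammaU B\<^esub> scalar_maps"
    if "f \<in> carrier (GammaU B)" for f
  proof -
    have f: "semisimilarity B f"
      using that by (simp add: GammaU_simps)
    then obtain \<sigma> where \<sigma>: "field_automorphism \<sigma>" "\<forall>a v. f (a *s v) = \<sigma> a *s f v"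
      unfolding semisimilarity_def by metis
    then have "bij \<sigma>" by (simp add: field_automorphism_def)
    \<comment> \<open>Moving a scalar \<open>a\<close> past \<open>f\<close> turns it into
      \<open>\<sigma> a\<close>. Since \<sigma> permutes the nonzero scalars, left and right cosets
      coincide.\<close>
    have "\<sigma> ` (- {0}) = - {0}"
      using field_automorphism_eq_0_iff[OF \<sigma>(1), of 0] \<open>bij \<sigma>\<close> by (simp add: bij_image_Compl_eq)
    then have "scalar_maps #>\<^bsub>GammaU B\<^esub> f = (\<lambda>a v. a *s f v) ` \<sigma> ` (- {0})"
      by (simp add: scalar_maps_r_coset[OF f])
    also have "\<dots> = f <#\<^bsub>GammaU B\<^esub> scalar_maps"
      using \<sigma>(2) by (simp add: image_image scalar_maps_l_coset[OF f])
    finally show ?thesis .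
  qed
  ultimately show ?thesis
    by (intro normalI) auto
qed

lemma carrier_PGammaU:
  "carrier (PGammaU B) = (\<lambda>f. scalar_maps #>\<^bsub>GammaU B\<^esub> f) ` {f. semisimilarity B f}"
  by (simp add: PGammaU_def carrier_FactGroup GammaU_simps)

section \<open>The action on totally isotropic subspaces\<close>

lemma PGammaU_action_coset:
  assumes f: "semisimilarity B f"
  shows "PGammaU_action B k (scalar_maps #>\<^bsub>GammaU B\<^esub> f) = (\<lambda>U\<in>totally_isotropic B k. f ` U)"
proof -
  have "(\<lambda>g. g ` U) ` (scalar_maps #>\<^bsub>GammaU B\<^esub> f) = {f ` U}" if U: "U \<in> totally_isotropic B k" for U
  proof -
    have "vec.subspace (f ` U)"
      using semisimilarity_totally_isotropic[OF f U] by (simp add: totally_isotropic_def)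
    then have im: "(\<lambda>v. a *s v) ` f ` U = f ` U" if "a \<noteq> 0" for a
      using that by (rule scalar_image_subspace)
    have "(\<lambda>v. a *s f v) ` U = f ` U" if "a \<noteq> 0" for a
      using im[OF that] by (simp add: image_image)
    then have "g ` U = f ` U" if "g \<in> scalar_maps #>\<^bsub>GammaU B\<^esub> f" for g
    proof -
      from that obtain a where "a \<noteq> 0" "g = (\<lambda>v. a *s f v)"
        unfolding scalar_maps_r_coset[OF f] by blast
      then show ?thesis
        using \<open>\<And>a. a \<noteq> 0 \<Longrightarrow> (\<lambda>v. a *s f v) ` U = f ` U\<close> by metis
    qed
    moreover have "(1::'a) \<in> - {0}"
      by simp
    then have "scalar_maps #>\<^bsub>GammaU B\<^esub> f \<noteq> {}"
      unfolding scalar_maps_r_coset[OF f] by blast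
    ultimately show ?thesis by blast
  qed
  then show ?thesis
    unfolding PGammaU_action_def by (intro restrict_ext) simp
qed

lemma PGammaU_action_Bij:
  assumes f: "semisimilarity B f"
  shows "(\<lambda>U\<in>totally_isotropic B k. f ` U) \<in> Bij (totally_isotropic B k)"
proof -
  have "inj_on ((`) f) (totally_isotropic B k)"
    using semisimilarity_inj[OF f] by (auto intro!: inj_onI simp: inj_image_eq_iff)
  moreover have "(`) f ` totally_isotropic B k \<subseteq> totally_isotropic B k"
    using semisimilarity_totally_isotropic[OF f] by blast
  ultimately have "bij_betw ((`) f) (totally_isotropic B k) (totally_isotropic B k)"
    by (simp add: bij_betw_def endo_inj_surj)
  then show ?thesis
    by (auto simp: Bij_def cong: bij_betw_cong)
qed

lemma PGammaU_transitive_action: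
  "transitive_action (PGammaU B) (totally_isotropic B k) (PGammaU_action B k)"
proof -
  let ?\<Omega> = "totally_isotropic B k"
  interpret N: normal scalar_maps "GammaU B" by (rule scalar_maps_normal)
  have "PGammaU_action B k \<in> hom (PGammaU B) (BijGroup ?\<Omega>)"
  proof (rule homI)
    fix S assume "S \<in> carrier (PGammaU B)"
    then show "PGammaU_action B k S \<in> carrier (BijGroup ?\<Omega>)"
      by (auto simp: carrier_PGammaU PGammaU_action_coset PGammaU_action_Bij BijGroup_def)
  next
    fix S T assume "S \<in> carrier (PGammaU B)" "T \<in> carrier (PGammaU B)"
    then obtain f g where fg: "semisimilarity B f" "semisimilarity B g"
      "S = scalar_maps #>\<^bsub>GammaU B\<^esub> f" "T = scalar_maps #>\<^bsub>GammaU B\<^esub> g"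
      by (auto simp: carrier_PGammaU)
    have "S \<otimes>\<^bsub>PGammaU B\<^esub> T = scalar_maps #>\<^bsub>GammaU B\<^esub> (f \<circ> g)"
      using N.rcos_sum[of f g] fg by (simp add: PGammaU_def GammaU_simps)
    then show "PGammaU_action B k (S \<otimes>\<^bsub>PGammaU B\<^esub> T) =
        PGammaU_action B k S \<otimes>\<^bsub>BijGroup ?\<Omega>\<^esub> PGammaU_action B k T"
      using fg PGammaU_action_Bij semisimilarity_totally_isotropic[OF fg(2), of _ k]
      by (auto simp: PGammaU_action_coset semisimilarity_comp BijGroup_def compose_def
          image_comp intro!: ext)
  qed
  then have "group_hom (PGammaU B) (BijGroup ?\<Omega>) (PGammaU_action B k)"
    using N.factorgroup_is_group group_BijGroup
    by (simp add: PGammaU_def group_hom_def group_hom_axioms_def)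
  moreover have "\<exists>g\<in>carrier (PGammaU B). PGammaU_action B k g U = V"
    if "U \<in> ?\<Omega>" "V \<in> ?\<Omega>" for U V
    using totally_isotropic_transitive[OF that] that(1)
    by (auto simp: carrier_PGammaU PGammaU_action_coset)
  ultimately show ?thesis
    by (simp add: transitive_action_def transitive_action_axioms_def group_action_def)
qed

end

section \<open>A trade of totally isotropic subspaces\<close>

lemma not_trivial_multisetI:
  assumes "U \<in> \<Omega>" "V \<in> \<Omega>" "W \<in> \<Omega>" "X U \<noteq> 0" "X V \<noteq> 0" "X W = 0" "U \<noteq> V"
  shows "\<not> trivial_multiset \<Omega> X"
proof
  assume "trivial_multiset \<Omega> X"
  then consider c where "\<forall>i\<in>\<Omega>. X i = c" | "\<exists>!i. i \<in> \<Omega> \<and> X i \<noteq> 0"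
    unfolding trivial_multiset_def by blast
  then show False
  proof cases
    case 1
    then have "X U = X W"
      using assms(1,3) by simp
    then show False
      using assms(4,6) by simp
  next
    case 2
    then show False
      using assms(1,2,4,5,7) by blast
  qed
qed

text \<open>Any \<open>Z\<close> meeting \<open>P\<close> and \<open>M\<close> equally often has
  \<open>X\<close>-weight \<open>card Z\<close>. Taking \<open>Z\<close> to be
  \<open>\<Omega>\<close> gives the divisibility, and taking the images of \<open>Y\<close> gives
  the constant \<open>card Y\<close>.\<close>

lemma non_spreading_tradeI:
  fixes \<Omega> :: "'b set"
  assumes trans: "transitive_action G \<Omega> \<phi>" and fin: "finite \<Omega>"
    and PM: "P \<subseteq> \<Omega>" "M \<subseteq> \<Omega>" "P \<inter> M = {}" "card P = card M" "1 < card P"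
    and Y: "Y \<subseteq> \<Omega>" "\<not> trivial_multiset \<Omega> (indicator Y)"
    and balanced: "\<And>g. g \<in> carrier G \<Longrightarrow> card (P \<inter> \<phi> g ` Y) = card (M \<inter> \<phi> g ` Y)"
  shows "non_spreading G \<Omega> \<phi>"
proof -
  \<comment> \<open>The complement of \<open>M\<close> avoids subtraction of naturals: the value is
    2 on \<open>P\<close>, 0 on \<open>M\<close> and 1 elsewhere.\<close>
  define X :: "'b \<Rightarrow> nat" where "X U = indicator P U + indicator (- M) U" for U
  interpret transitive_action G \<Omega> \<phi> by (rule trans)
  have sum_X: "(\<Sum>U\<in>Z. X U) = card Z" if "Z \<subseteq> \<Omega>" "card (P \<inter> Z) = card (M \<inter> Z)" for Z
  proof -
    have "finite Z" using that(1) fin finite_subset by blast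
    then have "(\<Sum>U\<in>Z. X U) = card (P \<inter> Z) + card (Z - M)"
      by (simp add: X_def sum.distrib sum_indicator_eq_card Int_commute Diff_eq)
    also have "\<dots> = card (M \<inter> Z) + card (Z - M)"
      using that(2) by simp
    also have "\<dots> = card Z"
      using \<open>finite Z\<close> by (metis Int_commute card_Int_Diff)
    finally show ?thesis .
  qed
  have finP: "finite P" "finite M"
    using PM fin finite_subset by blast+
  have "\<not> trivial_multiset \<Omega> X"
  proof -
    obtain U V where UV: "U \<in> P" "V \<in> P" "U \<noteq> V"
      using PM(5) card_le_Suc0_iff_eq[OF finP(1)] by (metis One_nat_def not_le)
    have "M \<noteq> {}"
      using PM(4,5) by auto
    then obtain W where "W \<in> M" by blast
    then have "X W = 0"
      using PM(3) by (auto simp: X_def indicator_def)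
    moreover have "X U \<noteq> 0" "X V \<noteq> 0"
      using UV by (simp_all add: X_def)
    ultimately show ?thesis
      using UV \<open>W \<in> M\<close> PM(1,2) by (intro not_trivial_multisetI[of U _ V W]) auto
  qed
  moreover have "msize \<Omega> X dvd card \<Omega>"
    using sum_X[of \<Omega>] PM by (simp add: msize_def Int_absorb2)
  moreover have "msize \<Omega> (mstar X (indicator (\<phi> g ` Y))) = card Y" if g: "g \<in> carrier G" for g
  proof -
    have bij: "bij_betw (\<phi> g) \<Omega> \<Omega>"
      using group_hom.hom_closed[OF group_hom g] by (simp add: BijGroup_def Bij_def)
    then have sub: "\<phi> g ` Y \<subseteq> \<Omega>" and c: "card (\<phi> g ` Y) = card Y"
      using Y(1) bij_betw_imp_surj_on[OF bij] inj_on_subset[OF bij_betw_imp_inj_on[OF bij] Y(1)]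
      by (blast, simp add: card_image)
    have "msize \<Omega> (mstar X (indicator (\<phi> g ` Y))) = (\<Sum>U\<in>\<Omega> \<inter> \<phi> g ` Y. X U)"
      using fin by (simp add: msize_def mstar_def indicator_def sum.If_cases if_distrib[of "(*) _"] cong: if_cong)
    also have "\<dots> = card Y"
      using sum_X[OF sub balanced[OF g]] sub c by (simp add: Int_absorb1)
    finally show ?thesis .
  qed
  ultimately show ?thesis
    unfolding non_spreading_def using fin trans Y by blast
qed

section \<open>The configuration and its families of joins\<close>

text \<open>Two hyperbolic pairs \<open>p\<close>, \<open>x0\<close> and \<open>a\<close>,
  \<open>b\<close> and a norm 1 vector \<open>v\<close>, all orthogonal to \<open>S\<close>. The
  vector \<open>x0\<close> serves as a member of \<open>Xi 0\<close>.\<close>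

locale trade_configuration = hermitian_space B q
  for B :: "'a::{field,finite} ^ 'd \<Rightarrow> 'a ^ 'd \<Rightarrow> 'a" and q +
  fixes S :: "('a ^ 'd) set" and p x0 a b v :: "'a ^ 'd" and k :: nat
  assumes S: "vec.subspace S" "vec.dim S + 2 = k" "\<And>s t. s \<in> S \<Longrightarrow> t \<in> S \<Longrightarrow> B s t = 0"
    and S_perp: "\<And>s. s \<in> S \<Longrightarrow> B s p = 0" "\<And>s. s \<in> S \<Longrightarrow> B s x0 = 0" "\<And>s. s \<in> S \<Longrightarrow> B s a = 0"
      "\<And>s. s \<in> S \<Longrightarrow> B s b = 0" "\<And>s. s \<in> S \<Longrightarrow> B s v = 0"
    and isotropic: "B p p = 0" "B x0 x0 = 0" "B a a = 0" "B b b = 0"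
    and units: "B p x0 = 1" "B a b = 1" "B v v = 1"
    and perp: "B p a = 0" "B p b = 0" "B p v = 0" "B a v = 0" "B b v = 0" "B x0 v = 0"
begin

lemma S_span: "vec.span S = S"
  using S(1) by (rule vec.span_eq_iff[THEN iffD2])

lemma perp': "B a p = 0" "B b p = 0" "B v p = 0" "B v a = 0" "B v b = 0" "B v x0 = 0"
  using perp B_eq_0_commute by blast+

lemma S_perp':
  assumes "s \<in> S"
  shows "B p s = 0" "B x0 s = 0" "B a s = 0" "B b s = 0" "B v s = 0"
  using S_perp[OF assms] B_eq_0_commute by blast+

lemma units': "B x0 p = 1" "B b a = 1"
  using units(1,2) B_conj[of x0 p] B_conj[of b a] by simp_all

lemma span_totally_isotropic:
  assumes "\<And>u w. u \<in> T \<Longrightarrow> w \<in> T \<Longrightarrow> B u w = 0"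
  shows "vec.span T \<in> totally_isotropic B (vec.dim T)"
proof -
  have "B u w = 0" if "u \<in> vec.span T" "w \<in> T" for u w
    using span_perp[OF that(1)] assms that(2) by blast
  then have "B u w = 0" if "u \<in> vec.span T" "w \<in> vec.span T" for u w
    using that span_perp[of w T u] B_eq_0_commute by blast
  then show ?thesis
    by (auto simp: totally_isotropic_def)
qed

text \<open>The normalisation \<open>B x p = 1\<close> selects exactly one vector from each point
  off the perp of \<open>p\<close>.\<close>

definition Xi :: "'a \<Rightarrow> ('a ^ 'd) set" where
  "Xi t = {x. B x x = 0 \<and> (\<forall>s\<in>S. B x s = 0) \<and> B x p = 1 \<and> B x v = t}"

text \<open>For \<open>B p x = 1\<close> the vector \<open>e - B e x *s p\<close> is the one in
  \<open>e + \<langle>p\<rangle>\<close> orthogonal to \<open>x\<close>.\<close>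

definition join :: "'a ^ 'd \<Rightarrow> 'a ^ 'd \<Rightarrow> ('a ^ 'd) set" where
  "join e x = vec.span (insert x (insert (e - B e x *s p) S))"

lemma join_iff: "u \<in> join e x \<longleftrightarrow> (\<exists>\<alpha> \<beta>. \<exists>s\<in>S. u = \<alpha> *s x + \<beta> *s (e - B e x *s p) + s)"
proof -
  have "u \<in> join e x \<longleftrightarrow> (\<exists>\<alpha> \<beta>. u - \<alpha> *s x - \<beta> *s (e - B e x *s p) \<in> S)"
    by (simp add: join_def vec.span_breakdown_eq S_span)
  also have "\<dots> \<longleftrightarrow> (\<exists>\<alpha> \<beta>. \<exists>s\<in>S. u = \<alpha> *s x + \<beta> *s (e - B e x *s p) + s)"
  proof -
    have "u - \<alpha> *s x - \<beta> *s (e - B e x *s p) \<in> S \<longleftrightarrow>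
        (\<exists>s\<in>S. u = \<alpha> *s x + \<beta> *s (e - B e x *s p) + s)" for \<alpha> \<beta>
      by (auto simp: algebra_simps intro!: bexI[of _ "u - \<alpha> *s x - \<beta> *s (e - B e x *s p)"])
    then show ?thesis by simp
  qed
  finally show ?thesis .
qed

text \<open>Lets the arguments for \<open>a\<close> and \<open>b\<close> be given once. In the last
  clause of \<open>axisD\<close>, \<open>w\<close> is the other vector of the hyperbolic
  pair.\<close>

definition axis :: "'a ^ 'd \<Rightarrow> bool" where
  "axis e \<longleftrightarrow> e = a \<or> e = b"

lemma axisD:
  assumes "axis e"
  shows "B e e = 0" "B e p = 0" "B p e = 0" "B e v = 0" "B v e = 0"
    "s \<in> S \<Longrightarrow> B e s = 0" "s \<in> S \<Longrightarrow> B s e = 0"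
    "\<exists>w. B e w = 1 \<and> B p w = 0 \<and> (\<forall>s\<in>S. B s w = 0)"
  using assms isotropic perp perp' S_perp S_perp' units units' unfolding axis_def by blast+

lemma XiD:
  assumes "x \<in> Xi t"
  shows "B x x = 0" "B x p = 1" "B p x = 1" "B x v = t" "s \<in> S \<Longrightarrow> B x s = 0" "s \<in> S \<Longrightarrow> B s x = 0"
  using assms B_conj[of p x] B_eq_0_commute[of x s] by (auto simp: Xi_def)

text \<open>The dimension is \<open>k\<close> because pairing with \<open>w\<close> separates
  \<open>f\<close> from \<open>S\<close>, and pairing with \<open>p\<close> separates
  \<open>x\<close> from \<open>f\<close> and \<open>S\<close>.\<close>

lemma join_totally_isotropic:
  assumes e: "axis e" and x: "x \<in> Xi t"
  shows "join e x \<in> totally_isotropic B k"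
proof -
  note e' = axisD[OF e] and x' = XiD[OF x]
  define f where "f = e - B e x *s p"
  obtain w where w: "B e w = 1" "B p w = 0" "\<forall>s\<in>S. B s w = 0"
    using e'(8) by blast
  have f: "B f f = 0" "B f p = 0" "B f w = 1" "B x f = 0" "B f x = 0" "\<And>s. s \<in> S \<Longrightarrow> B f s = 0"
    "\<And>s. s \<in> S \<Longrightarrow> B s f = 0"
    using e' x' w isotropic S_perp S_perp' B_conj[of x e] by (simp_all add: f_def B_simps)
  have "f \<notin> vec.span S"
    using f(3) w(3) by (auto simp: S_span)
  moreover have "x \<notin> vec.span (insert f S)"
    using span_perp[of x "insert f S" p] f(2) S_perp(1) x'(2) by auto
  ultimately have "vec.dim (insert x (insert f S)) = k"
    using S(2) by (simp add: vec.dim_insert)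
  moreover have "vec.span (insert x (insert f S)) \<in> totally_isotropic B (vec.dim (insert x (insert f S)))"
    by (rule span_totally_isotropic) (use f x' S(3) in auto)
  ultimately show ?thesis
    by (simp add: join_def f_def)
qed

lemma B_join_p:
  assumes "axis e" "x \<in> Xi t" "s \<in> S"
  shows "B (\<alpha> *s x + \<beta> *s (e - B e x *s p) + s) p = \<alpha>"
  using axisD[OF assms(1)] XiD[OF assms(2)] S_perp(1)[OF assms(3)] isotropic by (simp add: B_simps)

text \<open>Every normalised vector of a join generates it. Its coefficient at \<open>x\<close> is
  \<open>B r p = 1\<close>, and \<open>B e r = B e x\<close> because \<open>e\<close> is orthogonal
  to \<open>e\<close>, \<open>p\<close> and \<open>S\<close>; so the second generator is the same
  for \<open>r\<close> and \<open>x\<close>.\<close>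

lemma join_eq_of_mem:
  assumes e: "axis e" and x: "x \<in> Xi t" and r: "r \<in> join e x" "B r p = 1"
  shows "r \<in> Xi t" "join e r = join e x"
proof -
  note e' = axisD[OF e] and x' = XiD[OF x]
  obtain \<alpha> \<beta> s where s: "s \<in> S" and r': "r = \<alpha> *s x + \<beta> *s (e - B e x *s p) + s"
    using r by (auto simp: join_iff)
  have "\<alpha> = 1"
    using r(2) B_join_p[OF e x s, of \<alpha> \<beta>] by (simp only: r')
  then have r_eq: "r = x + \<beta> *s (e - B e x *s p) + s"
    using r' by simp
  have "S \<subseteq> join e x"
    by (auto simp: join_def intro: vec.span_base)
  then have "B r r = 0" "\<forall>s\<in>S. B r s = 0"
    using totally_isotropicD(3)[OF join_totally_isotropic[OF e x]] r(1) by blast+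
  moreover have "B r v = t"
    using x'(4) e'(4) perp(3) S_perp(5)[OF s] by (simp add: r_eq B_simps)
  ultimately show rXi: "r \<in> Xi t"
    using r(2) by (simp add: Xi_def)
  have "B e r = B e x"
    using e' s by (simp add: r_eq B_simps)
  then have "join e r \<subseteq> join e x"
    using r(1) unfolding join_def by (intro vec.span_minimal) (auto intro: vec.span_base)
  then show "join e r = join e x"
    using totally_isotropicD(1,2)[OF join_totally_isotropic[OF e x]]
      totally_isotropicD(1,2)[OF join_totally_isotropic[OF e rXi]]
    by (intro vec.subspace_dim_equal) auto
qed

section \<open>Counting the members of the families through a point\<close>

text \<open>The only candidate is the join of the normalised multiple of \<open>r\<close>. The
  resulting count does not depend on \<open>e\<close>, so the families of \<open>a\<close> and
  \<open>b\<close> agree here.\<close>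

lemma card_join_through_off_perp:
  assumes e: "axis e" and r: "B r p \<noteq> 0"
  shows "card {U \<in> join e ` Xi t. r \<in> U} = (if (1 / B r p) *s r \<in> Xi t then 1 else 0)"
proof -
  define r' where "r' = (1 / B r p) *s r"
  have r'p: "B r' p = 1"
    using r by (simp add: r'_def B_scale)
  have mem: "r \<in> U \<longleftrightarrow> r' \<in> U" if "vec.subspace U" for U
  proof -
    have "r = B r p *s r'"
      using r by (simp add: r'_def vec.scale_scale)
    then show ?thesis
      using vec.subspace_scale[OF that] r'_def by metis
  qed
  have sub: "vec.subspace (join e x)" for x
    by (simp add: join_def)
  have "join e r' = U \<and> r' \<in> Xi t" if "U \<in> join e ` Xi t" "r \<in> U" for U
  proof -
    obtain x where x: "x \<in> Xi t" "U = join e x"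
      using \<open>U \<in> join e ` Xi t\<close> by blast
    have "r' \<in> join e x"
      using mem[OF sub] that(2) x(2) by simp
    then show ?thesis
      using join_eq_of_mem[OF e x(1) _ r'p] x(2) by simp
  qed
  moreover have "r \<in> join e r'"
    using mem[OF sub, of r'] by (simp add: join_def vec.span_base)
  ultimately have "{U \<in> join e ` Xi t. r \<in> U} = {U. join e r' = U \<and> r' \<in> Xi t}"
    by (intro equalityI subsetI CollectI) (simp_all, metis imageI)
  then have "{U \<in> join e ` Xi t. r \<in> U} = (if r' \<in> Xi t then {join e r'} else {})"
    by simp
  then show ?thesis
    by (simp add: r'_def)
qed

text \<open>The shift is \<open>z = v + d p\<close> with \<open>d + d ^ q = - 1\<close>, which keeps \<open>x + z\<close> isotropic.\<close>

lemma exists_shift: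
  "\<exists>z. B z p = 0 \<and> B z v = 1 \<and> (\<forall>s\<in>S. B z s = 0) \<and> B a z = 0 \<and> B b z = 0 \<and>
    (\<forall>x. x \<in> Xi 0 \<longleftrightarrow> x + z \<in> Xi 1)"
proof -
  obtain d :: 'a where d: "d + d ^ q = - 1"
    using trace_surj[of "- 1"] by (auto simp: frobenius_minus)
  define z where "z = v + d *s p"
  have "B x z = B x v + d ^ q * B x p" "B z x = B v x + d * B p x" for x
    by (simp_all add: z_def B_simps)
  note Bz = this
  have zz: "B z z = 1"
    using units isotropic perp perp' by (simp add: Bz)
  \<comment> \<open>Adding \<open>z\<close> keeps the product with \<open>p\<close> and raises that
    with \<open>v\<close> by 1. Outside the case distinguished below, both memberships fail.\<close>
  have "(x \<in> Xi 0) = (x + z \<in> Xi 1)" for x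
  proof (cases "B x p = 1 \<and> B x v = 0")
    case True
    then have "B p x = 1" "B v x = 0"
      using B_conj[of p x] B_eq_0_commute[of x v] by auto
    then have "B x z = d ^ q" "B z x = d"
      using True by (simp_all add: Bz)
    then have "B (x + z) (x + z) = B x x + (d + d ^ q) + 1"
      using zz by (simp add: B_add B_add' add_ac)
    then show ?thesis
      using True perp perp' isotropic units S_perp' d by (auto simp: Xi_def B_add Bz)
  next
    case False
    then show ?thesis
      using perp perp' isotropic units by (auto simp: Xi_def B_add Bz)
  qed
  then show ?thesis
    using perp perp' isotropic units S_perp' by (intro exI[of _ z]) (simp add: Bz)
qed

text \<open>The transvection \<open>G\<close> fixes every vector orthogonal to \<open>p\<close>,
  including \<open>r\<close>, and acts on \<open>Xi 0\<close> as the shift by \<open>z\<close>. It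
  therefore matches the members through \<open>r\<close> of the two levels.\<close>

lemma card_join_through_perp:
  assumes e: "axis e" and r: "B r p = 0"
  shows "card {U \<in> join e ` Xi 0. r \<in> U} = card {U \<in> join e ` Xi 1. r \<in> U}"
proof -
  note e' = axisD[OF e]
  obtain z where z: "B z p = 0" "B a z = 0" "B b z = 0" and Xi_z: "\<And>x. x \<in> Xi 0 \<longleftrightarrow> x + z \<in> Xi 1"
    using exists_shift by blast
  \<comment> \<open>Ensures \<open>B e (x + z) = B e x\<close>, so that \<open>G\<close> fixes the
    second generator of the join.\<close>
  have ez: "B e z = 0"
    using e z by (auto simp: axis_def)
  define G where "G u = u + B u p *s z" for u
  have lin: "Vector_Spaces.linear (*s) (*s) G"
    by (simp add: Vector_Spaces.linear_iff vec.vector_space_axioms G_def B_simps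
        vec.scale_left_distrib vec.scale_right_distrib vec.scale_scale)
  have "inj G"
  proof (rule injI)
    fix u w assume eq: "G u = G w"
    then have "B (G u) p = B (G w) p" by simp
    then have "B u p = B w p"
      using z(1) by (simp add: G_def B_simps)
    then show "u = w"
      using eq by (simp add: G_def)
  qed
  have G_fix: "G u = u" if "B u p = 0" for u
    using that by (simp add: G_def)
  have G_join: "G ` join e x = join e (x + z)" if "x \<in> Xi 0" for x
  proof -
    have "G ` S = S"
      using G_fix S_perp(1) by force
    moreover have "G (e - B e x *s p) = e - B e x *s p"
      using e' isotropic by (intro G_fix) (simp add: B_simps)
    moreover have "G x = x + z"
      using XiD(2)[OF that] by (simp add: G_def)
    ultimately have "G ` insert x (insert (e - B e x *s p) S) = insert (x + z) (insert (e - B e x *s p) S)"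
      by simp
    then have "G ` join e x = vec.span (insert (x + z) (insert (e - B e x *s p) S))"
      unfolding join_def by (simp only: vec.linear_span_image[OF lin, symmetric])
    then show ?thesis
      using ez by (simp add: join_def B_add')
  qed
  have "Xi 1 = (\<lambda>x. x + z) ` Xi 0"
    using Xi_z by (auto simp: image_iff) (metis diff_add_cancel)
  then have "join e ` Xi 1 = (`) G ` join e ` Xi 0"
    using G_join by (auto simp: image_image cong: image_cong_simp)
  moreover have "{U \<in> H ` A. r \<in> U} = H ` {U \<in> A. r \<in> U}" if "H = (`) G" for H A
  proof -
    have "r \<in> H U \<longleftrightarrow> r \<in> U" for U
      using inj_image_mem_iff[OF \<open>inj G\<close>] G_fix[OF r] that by metis
    then show ?thesis by blast
  qed
  ultimately have "{U \<in> join e ` Xi 1. r \<in> U} = (`) G ` {U \<in> join e ` Xi 0. r \<in> U}"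
    by simp
  moreover have "inj_on ((`) G) A" for A
    using \<open>inj G\<close> by (auto intro!: inj_onI simp: inj_image_eq_iff)
  ultimately show ?thesis
    by (simp add: card_image)
qed

section \<open>Disjointness of the families and balance\<close>

text \<open>If the joins coincide, \<open>a - B a x *s p\<close> is a combination of
  \<open>y\<close>, \<open>b\<close>, \<open>p\<close> and \<open>S\<close>. Pairing with
  \<open>p\<close> removes \<open>y\<close>, and pairing with \<open>b\<close> then contradicts
  \<open>B a b = 1\<close>.\<close>

lemma join_axes_disjoint: "join a ` Xi s \<inter> join b ` Xi t = {}"
proof (intro equals0I, elim IntE imageE)
  fix U x y assume x: "x \<in> Xi s" and y: "y \<in> Xi t" and U: "U = join a x" "U = join b y"
  have ax: "axis a" "axis b" by (simp_all add: axis_def)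
  have "a - B a x *s p \<in> join b y"
    unfolding U(2)[symmetric] U(1) by (auto simp: join_def intro: vec.span_base)
  then obtain \<alpha> \<beta> w where w: "w \<in> S" and eq: "a - B a x *s p = \<alpha> *s y + \<beta> *s (b - B b y *s p) + w"
    by (auto simp: join_iff)
  have "\<alpha> = 0"
    using B_join_p[OF ax(2) y w, of \<alpha> \<beta>] perp' isotropic by (simp flip: eq add: B_simps)
  then have "B (a - B a x *s p) b = 0"
    using w S_perp isotropic perp by (simp add: eq B_simps)
  then show False
    using units perp by (simp add: B_simps)
qed

lemma join_axes_disjoint': "join b ` Xi t \<inter> join a ` Xi s = {}"
  by (subst Int_commute) (rule join_axes_disjoint)

text \<open>All normalised vectors of one join lie on the same level, by
  \<open>join_eq_of_mem\<close>.\<close>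

lemma join_levels_disjoint:
  assumes "axis e"
  shows "join e ` Xi 0 \<inter> join e ` Xi 1 = {}"
proof (intro equals0I, elim IntE imageE)
  fix U x y assume x: "x \<in> Xi 0" and y: "y \<in> Xi 1" and U: "U = join e x" "U = join e y"
  have "y \<in> join e x"
    unfolding U(1)[symmetric] U(2) by (auto simp: join_def intro: vec.span_base)
  then have "y \<in> Xi 0"
    using join_eq_of_mem(1)[OF assms x] XiD(2)[OF y] by blast
  then show False
    using XiD(4)[OF y] XiD(4)[of y 0] by simp
qed

text \<open>Off the perp of \<open>p\<close> the counts are swapped between the axes, on it between
  the levels. The value \<open>r = 0\<close> is allowed and compares the full families.\<close>

lemma balanced:
  "card {U \<in> join b ` Xi 0 \<union> join a ` Xi 1. r \<in> U} = card {U \<in> join a ` Xi 0 \<union> join b ` Xi 1. r \<in> U}"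
proof -
  have split: "card {U \<in> join e ` Xi s \<union> join e' ` Xi t. r \<in> U} =
      card {U \<in> join e ` Xi s. r \<in> U} + card {U \<in> join e' ` Xi t. r \<in> U}"
    if "join e ` Xi s \<inter> join e' ` Xi t = {}" for e e' s t
    using that by (subst card_Un_disjoint[symmetric]) (auto intro: arg_cong[of _ _ card])
  have ax: "axis a" "axis b" by (simp_all add: axis_def)
  show ?thesis
    using card_join_through_off_perp[OF ax(1), of r] card_join_through_off_perp[OF ax(2), of r]
      card_join_through_perp[OF ax(1), of r] card_join_through_perp[OF ax(2), of r]
      split[OF join_axes_disjoint] split[of b 0 a 1] join_axes_disjoint[of 1 0]
    by (cases "B r p = 0") (simp_all add: Int_commute)
qed

section \<open>The pencil of \<open>p\<close> and the conclusion for a configuration\<close>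

text \<open>The spans of \<open>p\<close>, \<open>S\<close> and one of \<open>a\<close>,
  \<open>b\<close> are two members, distinct because \<open>a\<close> and \<open>b\<close> are not
  orthogonal; \<open>join a x0\<close> misses \<open>p\<close>, since
  \<open>B p x0 = 1\<close>.\<close>

lemma pencil_nontrivial:
  "\<not> trivial_multiset (totally_isotropic B k) (indicator {U \<in> totally_isotropic B k. p \<in> U})"
proof -
  let ?\<Omega> = "totally_isotropic B k"
  let ?Y = "indicator {U \<in> ?\<Omega>. p \<in> U} :: ('a ^ 'd) set \<Rightarrow> nat"
  define pl where "pl e = vec.span (insert p (insert e S))" for e
  have x0: "x0 \<in> Xi 0"
    using isotropic units' perp S_perp' by (simp add: Xi_def)
  have pl: "pl e \<in> ?\<Omega>" if e: "axis e" for e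
  proof -
    note e' = axisD[OF e]
    obtain w where w: "B e w = 1" "B p w = 0" "\<forall>s\<in>S. B s w = 0"
      using e'(8) by blast
    have "e \<notin> vec.span S"
      using w by (auto simp: S_span)
    \<comment> \<open>Pairing with \<open>w\<close> kills the coefficient of \<open>e\<close>, and
      then \<open>p\<close> would be orthogonal to \<open>x0\<close>.\<close>
    moreover have "p \<notin> vec.span (insert e S)"
    proof
      assume "p \<in> vec.span (insert e S)"
      then obtain c s where "s \<in> S" "p = c *s e + s"
        by (metis S_span diff_add_cancel add.commute vec.span_breakdown_eq)
      then have "c = 0" "B p x0 = c * B e x0"
        using w S_perp by (auto simp: B_simps)
      then show False using units by simp
    qed
    ultimately have "vec.dim (insert p (insert e S)) = k"
      using S(2) by (simp add: vec.dim_insert)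
    moreover have "vec.span (insert p (insert e S)) \<in> totally_isotropic B (vec.dim (insert p (insert e S)))"
      by (rule span_totally_isotropic) (use e' isotropic S(3) S_perp S_perp' in auto)
    ultimately show ?thesis by (simp add: pl_def)
  qed
  have ax: "axis a" "axis b" by (simp_all add: axis_def)
  have "B a b = 0" if "pl a = pl b"
    using totally_isotropicD(3)[OF pl[OF ax(2)], of a b] that
    by (auto simp: pl_def intro: vec.span_base)
  then have "pl a \<noteq> pl b"
    using units by auto
  moreover have "?Y (pl a) = 1" "?Y (pl b) = 1"
    using pl[OF ax(1)] pl[OF ax(2)] by (simp_all add: pl_def vec.span_base)
  moreover have "p \<notin> join a x0"
  proof
    assume "p \<in> join a x0"
    moreover have "x0 \<in> join a x0"
      by (auto simp: join_def intro: vec.span_base)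
    ultimately have "B p x0 = 0"
      using totally_isotropicD(3)[OF join_totally_isotropic[OF ax(1) x0]] by blast
    then show False using units by simp
  qed
  then have "?Y (join a x0) = 0" by simp
  ultimately show ?thesis
    using pl[OF ax(1)] pl[OF ax(2)] join_totally_isotropic[OF ax(1) x0]
    by (intro not_trivial_multisetI[of "pl a" _ "pl b" "join a x0"]) simp_all
qed

lemma PGammaU_non_spreading:
  "non_spreading (PGammaU B) (totally_isotropic B k) (PGammaU_action B k)"
proof (rule non_spreading_tradeI[OF PGammaU_transitive_action])
  let ?\<Omega> = "totally_isotropic B k"
  let ?P = "join b ` Xi 0 \<union> join a ` Xi 1" and ?M = "join a ` Xi 0 \<union> join b ` Xi 1"
  have ax: "axis a" "axis b" by (simp_all add: axis_def)
  show "finite ?\<Omega>" by simp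
  show P: "?P \<subseteq> ?\<Omega>" and M: "?M \<subseteq> ?\<Omega>"
    using join_totally_isotropic ax by auto
  have disjoint: "(W \<union> X) \<inter> (Y \<union> Z) = {}"
    if "W \<inter> Y = {}" "W \<inter> Z = {}" "Y \<inter> X = {}" "X \<inter> Z = {}" for W X Y Z :: "('a ^ 'd) set set"
    using that by blast
  show "?P \<inter> ?M = {}"
    by (rule disjoint) (rule join_axes_disjoint join_axes_disjoint' join_levels_disjoint ax)+
  \<comment> \<open>Every member contains the zero vector, so balance at 0 gives equal
    cardinalities.\<close>
  have "0 \<in> U" if "U \<in> ?\<Omega>" for U
    using totally_isotropicD(1)[OF that] by (rule vec.subspace_0)
  then have filter_0: "{U \<in> Z. 0 \<in> U} = Z" if "Z \<subseteq> ?\<Omega>" for Z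
    using that by blast
  show "card ?P = card ?M"
    using balanced[of 0] unfolding filter_0[OF P] filter_0[OF M] .
  have "x0 \<in> Xi 0"
    using isotropic units' perp S_perp' by (simp add: Xi_def)
  moreover obtain z where "x0 + z \<in> Xi 1"
    using exists_shift \<open>x0 \<in> Xi 0\<close> by blast
  ultimately have "{join b x0, join a (x0 + z)} \<subseteq> ?P" "join b x0 \<noteq> join a (x0 + z)"
    using join_axes_disjoint[of 1 0] by blast+
  then show "1 < card ?P"
    using card_mono[of ?P "{join b x0, join a (x0 + z)}"] by simp
  show "{U \<in> ?\<Omega>. p \<in> U} \<subseteq> ?\<Omega>" by blast
  show "\<not> trivial_multiset ?\<Omega> (indicator {U \<in> ?\<Omega>. p \<in> U})"
    by (rule pencil_nontrivial)
  fix g assume "g \<in> carrier (PGammaU B)"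
  then obtain f where f: "semisimilarity B f" "g = scalar_maps #>\<^bsub>GammaU B\<^esub> f"
    by (auto simp: carrier_PGammaU)
  have surj: "(`) f ` ?\<Omega> = ?\<Omega>"
    using PGammaU_action_Bij[OF f(1), of k] by (simp add: Bij_def bij_betw_def)
  \<comment> \<open>The image of the pencil of \<open>p\<close> is the pencil of \<open>f p\<close>,
    because \<open>f\<close> permutes the totally isotropic subspaces.\<close>
  have "PGammaU_action B k g ` {U \<in> ?\<Omega>. p \<in> U} = (`) f ` {U \<in> ?\<Omega>. p \<in> U}"
    unfolding f(2) PGammaU_action_coset[OF f(1)] by (intro image_cong) auto
  also have "\<dots> = {U \<in> (`) f ` ?\<Omega>. f p \<in> U}"
    using inj_image_mem_iff[OF semisimilarity_inj[OF f(1)]] by auto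
  finally have im: "PGammaU_action B k g ` {U \<in> ?\<Omega>. p \<in> U} = {U \<in> ?\<Omega>. f p \<in> U}"
    by (simp only: surj)
  have filter_fp: "Z \<inter> {U \<in> ?\<Omega>. f p \<in> U} = {U \<in> Z. f p \<in> U}" if "Z \<subseteq> ?\<Omega>" for Z
    using that by blast
  show "card (?P \<inter> PGammaU_action B k g ` {U \<in> ?\<Omega>. p \<in> U}) =
      card (?M \<inter> PGammaU_action B k g ` {U \<in> ?\<Omega>. p \<in> U})"
    unfolding im filter_fp[OF P] filter_fp[OF M] by (rule balanced)
qed

end

section \<open>Existence of a configuration and the final result\<close>

text \<open>From an orthonormal basis, \<open>s i\<close> and \<open>h i\<close> form hyperbolic
  pairs for \<open>i < k\<close>. Indices 0 and 1 supply \<open>p\<close>, \<open>x0\<close> and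
  \<open>a\<close>, \<open>b\<close>, the others span \<open>S\<close>, and \<open>y (2 * k)\<close>
  is a basis vector left over for \<open>v\<close>.\<close>

lemma (in hermitian_space) exists_trade_configuration:
  assumes "2 \<le> k" "2 * k + 1 \<le> CARD('d)"
  shows "\<exists>S p x0 a b v. trade_configuration B q S p x0 a b v k"
proof -
  obtain \<alpha> :: 'a where \<alpha>: "\<alpha> * \<alpha> ^ q = -1"
    using exists_norm_minus_1 by blast
  \<comment> \<open>The norm of \<open>h i\<close> is \<open>1 + \<delta> + \<delta> ^ q\<close>, so
    this trace makes it isotropic.\<close>
  obtain \<delta> :: 'a where \<delta>: "\<delta> + \<delta> ^ q = - 1"
    using trace_surj[of "- 1"] by (auto simp: frobenius_minus)
  obtain y where y: "orthonormal y CARD('d)"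
    using orthonormal_complete[of _ 0] by (auto simp: orthonormal_def)
  define s where "s = iso_vec \<alpha> y"
  have y2k: "orthonormal y (2 * k)"
    using orthonormal_mono[OF y] assms by simp
  have ss: "B (s i) (s j) = 0" if "i < k" "j < k" for i j
    unfolding s_def using iso_vec_isotropic[OF y2k \<alpha> that] .
  have sy: "B (s i) (y (2 * j)) = (if i = j then 1 else 0)" "B (y (2 * j)) (s i) = (if i = j then 1 else 0)"
    if "i < k" "j \<le> k" for i j
  proof -
    have "2 * j \<noteq> Suc (2 * i)" "Suc (2 * i) \<noteq> 2 * j" by presburger+
    then show "B (s i) (y (2 * j)) = (if i = j then 1 else 0)" "B (y (2 * j)) (s i) = (if i = j then 1 else 0)"
      using that assms y by (auto simp: s_def iso_vec_def B_simps orthonormalD)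
  qed
  have yy: "B (y (2 * i)) (y (2 * j)) = (if i = j then 1 else 0)" if "i \<le> k" "j \<le> k" for i j
    using that assms y by (auto simp: orthonormalD)
  define S where "S = vec.span (s ` {2..<k})"
  define h where "h i = y (2 * i) + \<delta> *s s i" for i
  have hh: "B (h i) (h i) = 0" if "i < k" for i
    using sy[of i i] ss[of i i] yy[of i i] that \<delta> by (simp add: h_def B_simps algebra_simps)
  have S_perp: "B u w = 0" if "u \<in> S" "\<And>i. 2 \<le> i \<Longrightarrow> i < k \<Longrightarrow> B (s i) w = 0" for u w
    by (rule span_perp[OF that(1)[unfolded S_def]]) (use that(2) in auto)
  have sh: "B (s i) (h j) = (if i = j then 1 else 0)" "B (h j) (y (2 * k)) = 0"
    if "i < k" "j < k" for i j
    using sy ss yy that by (simp_all add: h_def B_simps)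
  have "vec.dim S = k - 2"
  proof -
    have "{2..<k} = (\<lambda>i. i + 2) ` {..<k - 2}"
      using assms(1) image_add_atLeastLessThan'[of 2 0 "k - 2"]
      by (simp only: lessThan_atLeast0 add_0 le_add_diff_inverse2)
    then have "s ` {2..<k} = (\<lambda>i. s (i + 2)) ` {..<k - 2}"
      by (simp add: image_image)
    moreover have "vec.dim ((\<lambda>i. s (i + 2)) ` {..<k - 2}) = k - 2"
    proof (rule dim_triangular)
      fix i assume "i < k - 2"
      then show "\<exists>w. B (s (i + 2)) w \<noteq> 0 \<and> (\<forall>j<i. B (s (j + 2)) w = 0)"
        using sy(1)[of _ "i + 2"] by (intro exI[of _ "y (2 * (i + 2))"]) simp
    qed
    ultimately show ?thesis by (simp add: S_def)
  qed
  have "trade_configuration B q S (s 0) (h 0) (s 1) (h 1) (y (2 * k)) k"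
  proof (unfold_locales)
    show "vec.subspace S" by (simp add: S_def)
    show "vec.dim S + 2 = k" using \<open>vec.dim S = k - 2\<close> assms by simp
    show "B u w = 0" if "u \<in> S" "w \<in> S" for u w
    proof (rule S_perp[OF that(1)])
      fix i assume "2 \<le> i" "i < k"
      then have "B w (s i) = 0"
        using ss by (intro S_perp[OF that(2)]) auto
      then show "B (s i) w = 0" using B_eq_0_commute by blast
    qed
    have k: "0 < k" "1 < k" using assms(1) by auto
    show "B (s 0) (s 0) = 0" "B (s 1) (s 1) = 0" "B (s 0) (s 1) = 0"
      using ss k by simp_all
    show "B (h 0) (h 0) = 0" "B (h 1) (h 1) = 0" "B (s 0) (h 0) = 1" "B (s 1) (h 1) = 1"
      "B (s 0) (h 1) = 0" "B (h 0) (y (2 * k)) = 0" "B (h 1) (y (2 * k)) = 0"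
      using hh sh k by simp_all
    show "B (y (2 * k)) (y (2 * k)) = 1" "B (s 0) (y (2 * k)) = 0" "B (s 1) (y (2 * k)) = 0"
      using sy(1)[of _ k] yy[of k k] k by simp_all
    fix u assume u: "u \<in> S"
    show "B u (s 0) = 0" "B u (s 1) = 0" "B u (h 0) = 0" "B u (h 1) = 0" "B u (y (2 * k)) = 0"
      using ss sh sy(1)[of _ k] k by (auto intro!: S_perp[OF u])
  qed
  then show ?thesis by blast
qed

theorem theorem4p3:
  fixes B :: "'a::{field,finite} ^ 'd \<Rightarrow> 'a ^ 'd \<Rightarrow> 'a"
    and n q k :: nat
  assumes "n \<ge> 2"
    and "primepow q"
    and "1 < k" and "k \<le> n"
    and "CARD('a) = q\<^sup>2"
    and "CARD('d) = 2 * n + 1"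
    and "hermitian_form q B"
    and "nondegenerate B"
  shows "non_spreading (PGammaU B) (totally_isotropic B k) (PGammaU_action B k)"
proof -
  interpret hermitian_space B q
    using assms by unfold_locales
  obtain S p x0 a b v where "trade_configuration B q S p x0 a b v k"
    using exists_trade_configuration[of k] assms by auto
  then show ?thesis
    by (rule trade_configuration.PGammaU_non_spreading)
qed

end
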